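(* For any arbitrarily small constant $\gamma>0$, PIQP can be approximated to within a factor of $O\!\left(a_{\max}\sqrt{n}\,\log^{2+\gamma}n\right)$ with high probability in polynomial time, where $a_{\max}$ is the maximum entry of the constraint matrix.
   Context: PIQP (Positive 0-1 Quadratic Program): given a symmetric matrix $B=(b_{ij})\in\mathbb{Z}_{\geq 0}^{n\times n}$, a positive integer vector $c$, a bounded number $p$ of constraint vectors $a_1,\dots,a_p$ with nonnegative integer entries $a_{ij}$, and positive bounds $W_1,\dots,W_p$, maximize $X^TBX+c^TX$ subject to $a_i^TX\leq W_i$ ($i=1,\dots,p$) and $X\in\{0,1\}^n$. Approximating within factor $\alpha$ means outputting a feasible solution whose objective value is at least $1/\alpha$ times the optimum. *)

theory Defs
  imports
    "HOL-Probability.Probability_Mass_Function"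
    "HOL-Library.Log_Nat"
    "HOL-Computational_Algebra.Polynomial"
    "Jordan_Normal_Form.Matrix"
begin

no_notation vec_nth (infixl "$" 90)
unbundle no inner_syntax
hide_const (open) Finite_Cartesian_Product.vec Finite_Cartesian_Product.row

section \<open>Positive 0-1 quadratic programs\<close>

text \<open>An instance: maximise \<open>x \<bullet> (quad *\<^sub>v x) + lin \<bullet> x\<close> over 0-1 vectors \<open>x\<close>
  subject to \<open>con *\<^sub>v x \<le> bnd\<close>. The rows of \<open>con\<close> are the vectors \<open>a\<^sub>1, \<dots>, a\<^sub>p\<close>.
  The coefficients are integers; the bounds may be arbitrary positive rationals.\<close>

record piqp =
  quad :: "nat mat"
  lin :: "nat vec"
  con :: "nat mat"
  bnd :: "rat vec"

definition num_vars :: "piqp \<Rightarrow> nat" where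
  "num_vars I = dim_vec (lin I)"

definition num_cons :: "piqp \<Rightarrow> nat" where
  "num_cons I = dim_vec (bnd I)"

definition is_piqp :: "piqp \<Rightarrow> bool" where
  "is_piqp I \<longleftrightarrow>
     1 \<le> num_vars I \<and> 1 \<le> num_cons I \<and>
     quad I \<in> carrier_mat (num_vars I) (num_vars I) \<and>
     transpose_mat (quad I) = quad I \<and>
     (\<forall>j<num_vars I. 0 < lin I $ j) \<and>
     con I \<in> carrier_mat (num_cons I) (num_vars I) \<and>
     (\<forall>i<num_cons I. 0 < bnd I $ i)"

definition objective :: "piqp \<Rightarrow> nat vec \<Rightarrow> nat" where
  "objective I x = x \<bullet> (quad I *\<^sub>v x) + lin I \<bullet> x"

definition feasible :: "piqp \<Rightarrow> nat vec \<Rightarrow> bool" where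
  "feasible I x \<longleftrightarrow>
     x \<in> carrier_vec (num_vars I) \<and>
     (\<forall>j<num_vars I. x $ j \<in> {0, 1}) \<and>
     (\<forall>i<num_cons I. of_nat (row (con I) i \<bullet> x) \<le> bnd I $ i)"

definition optimum :: "piqp \<Rightarrow> nat" where
  "optimum I = Max (objective I ` {x. feasible I x})"

definition approx_solution :: "piqp \<Rightarrow> real \<Rightarrow> nat vec \<Rightarrow> bool" where
  "approx_solution I \<alpha> x \<longleftrightarrow>
     feasible I x \<and> real (objective I x) \<ge> 1 / \<alpha> * real (optimum I)"

definition a_max :: "piqp \<Rightarrow> nat" where
  "a_max I = Max (elements_mat (con I))"

text \<open>The maximum over which \<^const>\<open>optimum\<close> is taken is over a finite nonempty set.\<close>

lemma finite_feasible: "finite {x. feasible I x}"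
proof (rule finite_subset)
  let ?n = "num_vars I"
  show "{x. feasible I x} \<subseteq> vec_of_list ` {l. set l \<subseteq> {0, 1} \<and> length l = ?n}"
  proof
    fix x assume "x \<in> {x. feasible I x}"
    then have "dim_vec x = ?n" "\<forall>j<?n. x $ j \<in> {0, 1}"
      by (auto simp: feasible_def)
    then have "list_of_vec x \<in> {l. set l \<subseteq> {0, 1} \<and> length l = ?n}"
      by (fastforce simp: in_set_conv_nth)
    moreover have "x = vec_of_list (list_of_vec x)"
      by (simp add: vec_list)
    ultimately show "x \<in> vec_of_list ` {l. set l \<subseteq> {0, 1} \<and> length l = ?n}"
      by blast
  qed
  show "finite (vec_of_list ` {l::nat list. set l \<subseteq> {0, 1} \<and> length l = ?n})"
    by (intro finite_imageI finite_lists_length_eq) simp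
qed

lemma feasible_zero:
  assumes "is_piqp I"
  shows "feasible I (0\<^sub>v (num_vars I))"
proof -
  have "row (con I) i \<in> carrier_vec (num_vars I)" if "i < num_cons I" for i
    using assms that by (auto simp: is_piqp_def)
  then show ?thesis
    using assms by (auto simp: feasible_def is_piqp_def less_imp_le)
qed


section \<open>Randomised programs with logarithmic cost\<close>

text \<open>A structured random access machine over natural numbers of unbounded size, with coin
  tossing and the logarithmic cost criterion: every operation is charged the bit lengths of all
  addresses and operands involved. Up to a polynomial, its running times are those of
  (probabilistic) Turing machines. The memory consists of arrays, of which a program can mention
  only finitely many; scalar variables are arrays used at index 0 only. Subtraction is truncated and
  division is rounded down (with result 0 if the divisor is 0).\<close>

datatype expr =
    Const nat
  | Get nat expr
  | Add expr expr
  | Sub expr expr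
  | Mul expr expr
  | Div expr expr

datatype com =
    Skip
  | Put nat expr expr
  | Toss nat expr
  | Seq com com
  | Cond expr com com
  | While expr com

type_synonym mem = "nat \<Rightarrow> nat \<Rightarrow> nat"

definition put :: "mem \<Rightarrow> nat \<Rightarrow> nat \<Rightarrow> nat \<Rightarrow> mem" where
  "put M a i v = M(a := (M a)(i := v))"

fun val :: "expr \<Rightarrow> mem \<Rightarrow> nat" where
  "val (Const k) M = k"
| "val (Get a e) M = M a (val e M)"
| "val (Add e f) M = val e M + val f M"
| "val (Sub e f) M = val e M - val f M"
| "val (Mul e f) M = val e M * val f M"
| "val (Div e f) M = val e M div val f M"

abbreviation bits :: "nat \<Rightarrow> nat" where
  "bits k \<equiv> floorlog 2 k"

fun cost :: "expr \<Rightarrow> mem \<Rightarrow> nat" where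
  "cost (Const k) M = 1 + bits k"
| "cost (Get a e) M = cost e M + 1 + bits (val e M) + bits (M a (val e M))"
| "cost (Add e f) M = cost e M + cost f M + 1 + bits (val e M) + bits (val f M)"
| "cost (Sub e f) M = cost e M + cost f M + 1 + bits (val e M) + bits (val f M)"
| "cost (Mul e f) M = cost e M + cost f M + 1 + bits (val e M) + bits (val f M)"
| "cost (Div e f) M = cost e M + cost f M + 1 + bits (val e M) + bits (val f M)"

text \<open>\<open>exec c M rs t M' rs'\<close>: started in memory \<open>M\<close> with the sequence \<open>rs\<close> of coin tosses ahead,
  \<open>c\<close> halts at cost \<open>t\<close> in memory \<open>M'\<close>, with the tosses \<open>rs'\<close> not yet used.
  Conditions hold iff their value is nonzero.\<close>

inductive exec :: "com \<Rightarrow> mem \<Rightarrow> bool list \<Rightarrow> nat \<Rightarrow> mem \<Rightarrow> bool list \<Rightarrow> bool" where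
  Skip: "exec Skip M rs 1 M rs"
| Put: "exec (Put a e f) M rs (cost e M + cost f M + 1 + bits (val e M) + bits (val f M))
          (put M a (val e M) (val f M)) rs"
| Toss: "exec (Toss a e) M (r # rs) (cost e M + 1 + bits (val e M))
          (put M a (val e M) (of_bool r)) rs"
| Seq: "exec c M rs t M' rs' \<Longrightarrow> exec d M' rs' t' M'' rs'' \<Longrightarrow>
          exec (Seq c d) M rs (t + t') M'' rs''"
| CondTrue: "val e M \<noteq> 0 \<Longrightarrow> exec c M rs t M' rs' \<Longrightarrow>
          exec (Cond e c d) M rs (cost e M + 1 + t) M' rs'"
| CondFalse: "val e M = 0 \<Longrightarrow> exec d M rs t M' rs' \<Longrightarrow>
          exec (Cond e c d) M rs (cost e M + 1 + t) M' rs'"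
| WhileFalse: "val e M = 0 \<Longrightarrow> exec (While e c) M rs (cost e M + 1) M rs"
| WhileTrue: "val e M \<noteq> 0 \<Longrightarrow> exec c M rs t M' rs' \<Longrightarrow> exec (While e c) M' rs' t' M'' rs'' \<Longrightarrow>
          exec (While e c) M rs (cost e M + 1 + t + t') M'' rs''"

inductive_cases SkipE: "exec Skip M rs t M' rs'"
inductive_cases PutE: "exec (Put a e f) M rs t M' rs'"
inductive_cases TossE: "exec (Toss a e) M rs t M' rs'"
inductive_cases SeqE: "exec (Seq c d) M rs t M' rs'"
inductive_cases CondE: "exec (Cond e c d) M rs t M' rs'"
inductive_cases WhileE: "exec (While e c) M rs t M' rs'"

lemma exec_deterministic:
  "exec c M rs t M1 rs1 \<Longrightarrow> exec c M rs u M2 rs2 \<Longrightarrow> t = u \<and> M1 = M2 \<and> rs1 = rs2"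
proof (induction arbitrary: u M2 rs2 rule: exec.induct)
  case (Seq c M rs t M' rs' d t' M'' rs'')
  from Seq.prems obtain t1 N ss t2
    where 1: "exec c M rs t1 N ss" and 2: "exec d N ss t2 M2 rs2" and u: "u = t1 + t2"
    by (rule SeqE)
  from Seq.IH(1)[OF 1] have "t = t1" "N = M'" "ss = rs'" by simp_all
  with Seq.IH(2) 2 u show ?case by simp
next
  case (CondTrue e M c rs t M' rs' d)
  from CondTrue.prems show ?case
    by (rule CondE) (use CondTrue.hyps(1) CondTrue.IH in auto)
next
  case (CondFalse e M d rs t M' rs' c)
  from CondFalse.prems show ?case
    by (rule CondE) (use CondFalse.hyps(1) CondFalse.IH in auto)
next
  case (WhileFalse e M c rs)
  from WhileFalse.prems show ?case
    by (rule WhileE) (use WhileFalse.hyps in auto)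
next
  case (WhileTrue e M c rs t M' rs' t' M'' rs'')
  from WhileTrue.prems WhileTrue.hyps(1) obtain t1 N ss t2
    where 1: "exec c M rs t1 N ss" and 2: "exec (While e c) N ss t2 M2 rs2"
      and u: "u = cost e M + 1 + t1 + t2"
    by (auto elim: WhileE)
  from WhileTrue.IH(1)[OF 1] have "t = t1" "N = M'" "ss = rs'" by simp_all
  with WhileTrue.IH(2) 2 u show ?case by simp
qed (auto elim: SkipE PutE TossE)

lemma exec_tosses_le_cost:
  "exec c M rs t M' rs' \<Longrightarrow> \<exists>us. rs = us @ rs' \<and> length us \<le> t"
proof (induction rule: exec.induct)
  case (Seq c M rs t M' rs' d t' M'' rs'')
  then obtain us vs where "rs = us @ rs'" "length us \<le> t" "rs' = vs @ rs''" "length vs \<le> t'"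
    by blast
  then show ?case by (intro exI[of _ "us @ vs"]) simp
next
  case (WhileTrue e M c rs t M' rs' t' M'' rs'')
  then obtain us vs where "rs = us @ rs'" "length us \<le> t" "rs' = vs @ rs''" "length vs \<le> t'"
    by blast
  then show ?case by (intro exI[of _ "us @ vs"]) simp
qed fastforce+

text \<open>The input is a list of numbers in array 0, the output is read off array 1; everything else is
  initially 0. The size of an input is its length in binary, with a separator for each number.\<close>

definition init_mem :: "nat list \<Rightarrow> mem" where
  "init_mem xs = (\<lambda>a i. if a = 0 \<and> i < length xs then xs ! i else 0)"

definition input_size :: "nat list \<Rightarrow> nat" where
  "input_size xs = (\<Sum>x\<leftarrow>xs. bits x + 1)"

definition halts_within :: "com \<Rightarrow> nat list \<Rightarrow> nat \<Rightarrow> bool" where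
  "halts_within c xs T \<longleftrightarrow>
     (\<forall>rs. length rs = T \<longrightarrow> (\<exists>t M' rs'. exec c (init_mem xs) rs t M' rs' \<and> t \<le> T))"

text \<open>The probability that the output satisfies \<open>P\<close>, for \<open>T\<close> independent fair coin tosses. Since
  a toss costs at least 1, \<open>T\<close> tosses suffice for a program halting within cost \<open>T\<close>.\<close>

definition output_prob :: "com \<Rightarrow> nat list \<Rightarrow> nat \<Rightarrow> ((nat \<Rightarrow> nat) \<Rightarrow> bool) \<Rightarrow> real" where
  "output_prob c xs T P =
     measure_pmf.prob (pmf_of_set {rs. length rs = T})
       {rs. \<exists>t M' rs'. exec c (init_mem xs) rs t M' rs' \<and> P (M' 1)}"

text \<open>The encoding of an instance: the dimensions, then all entries, matrices row by row, and each
  bound as numerator and denominator (in lowest terms).\<close>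

definition encode :: "piqp \<Rightarrow> nat list" where
  "encode I =
     [num_vars I, num_cons I] @ concat (mat_to_list (quad I)) @ list_of_vec (lin I) @
     concat (mat_to_list (con I)) @
     concat (map (\<lambda>w. case quotient_of w of (u, v) \<Rightarrow> [nat u, nat v]) (list_of_vec (bnd I)))"

end

theory Submission
  imports Defs
begin

text \<open>
  A deterministic algorithm already achieves the factor \<open>O(a\<^sub>m\<^sub>a\<^sub>x * sqrt n)\<close>. Adding items greedily by
  their value, as long as they fit, solves a linear packing problem up to the factor
  \<open>O(p * a\<^sub>m\<^sub>a\<^sub>x)\<close>. Call an item light if it uses at most the fraction \<open>1 / (2 * sqrt n)\<close> of each
  budget. An optimal solution \<open>X\<close> has at most \<open>2 * p * sqrt n\<close> heavy items, and the contribution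
  of all products with a fixed \<open>v \<in> X\<close> is a linear objective; so the greedy solutions starting from
  \<open>{v}\<close>, for all \<open>v\<close>, account for the linear part of the objective and for all products with a heavy
  item. For the products of light items, let \<open>S\<close> be chosen greedily within half of the budgets by
  the degrees into the set of light items. At least \<open>sqrt n\<close> light items, roughly, of the at most
  \<open>n\<close> then fit into the other half, and choosing them greedily by their degrees into \<open>S\<close> loses
  only another factor \<open>O(sqrt n)\<close>.
\<close>

section \<open>Bounded loops with polynomial cost\<close>

text \<open>The threshold for light items balances two losses: each heavy item costs one star, that
  is, all products with one fixed item, while in the light part at most \<open>n\<close> items
  compete with the roughly \<open>sqrt n\<close> that surely fit. In the light part, with L the set
  of light items, the products inside \<open>X\<close> are at most the degrees of \<open>X\<close>
  into L, which \<open>S\<close> matches up to \<open>O(p * a_max)\<close>. Since the matrix is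
  symmetric, the degrees of \<open>S\<close> into L are the degrees of L into \<open>S\<close>, so a
  second greedy choice by these degrees turns them into actual products. That choice is compared by
  counting with all items at once, not by charging rejections; hence \<open>a_max\<close> enters
  only once. Nothing is random, so success is certain, and the logarithmic factor is slack once
  \<open>n \<ge> 2\<close>. What remains is the machine model: the algorithm is written in a
  language of counting loops, where the meaning is a total function and the running time can be read
  off the syntax.\<close>

datatype prog =
    Nop
  | Assign nat expr expr
  | Then prog prog (infixr ";;" 60)
  | IfElse expr prog prog
  | For nat nat prog

abbreviation var :: "nat \<Rightarrow> expr" where
  "var a \<equiv> Get a (Const 0)"

primrec compile :: "prog \<Rightarrow> com" where
  "compile Nop = Skip"
| "compile (Assign a e f) = Put a e f"
| "compile (c ;; d) = Seq (compile c) (compile d)"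
| "compile (IfElse e c d) = Cond e (compile c) (compile d)"
| "compile (For x k c) =
     Seq (Put x (Const 0) (Const 0))
       (While (Sub (Get 0 (Const k)) (var x))
         (Seq (compile c) (Put x (Const 0) (Add (var x) (Const 1)))))"

text \<open>A total function, because the number of iterations is read before a loop starts. The
  compiled loop reads its limit anew in each round; under \<open>wf\<close> the two agree.\<close>

primrec sem :: "prog \<Rightarrow> mem \<Rightarrow> mem" where
  "sem Nop M = M"
| "sem (Assign a e f) M = put M a (val e M) (val f M)"
| "sem (c ;; d) M = sem d (sem c M)"
| "sem (IfElse e c d) M = (if val e M \<noteq> 0 then sem c M else sem d M)"
| "sem (For x k c) M =
     ((\<lambda>N. put (sem c N) x 0 (sem c N x 0 + 1)) ^^ (M 0 k)) (put M x 0 0)"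

primrec writes :: "prog \<Rightarrow> nat set" where
  "writes Nop = {}"
| "writes (Assign a e f) = {a}"
| "writes (c ;; d) = writes c \<union> writes d"
| "writes (IfElse e c d) = writes c \<union> writes d"
| "writes (For x k c) = insert x (writes c)"

text \<open>Addresses are unrestricted: a cell of the input is short wherever it lies, so the length
  of such a value is bounded by the input and the expression alone.\<close>

fun static :: "expr \<Rightarrow> bool" where
  "static (Const k) = True"
| "static (Get a e) = (a = 0)"
| "static (Add e f) = (static e \<and> static f)"
| "static (Sub e f) = (static e \<and> static f)"
| "static (Mul e f) = (static e \<and> static f)"
| "static (Div e f) = (static e \<and> static f)"

text \<open>The form of values that may be stored. Storing products of mutable cells would allow
  repeated squaring, which doubles bit lengths in each round.\<close>

fun slow :: "expr \<Rightarrow> bool" where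
  "slow (Const k) = True"
| "slow (Get a e) = True"
| "slow (Add (Get a e) f) = static f"
| "slow _ = False"

text \<open>The input is read-only, so loop limits cannot change. Its cells 0 and 1 hold the numbers
  of variables and of constraints, the only limits needed.\<close>

primrec wf :: "prog \<Rightarrow> bool" where
  "wf Nop = True"
| "wf (Assign a e f) = (a \<noteq> 0 \<and> slow f)"
| "wf (c ;; d) = (wf c \<and> wf d)"
| "wf (IfElse e c d) = (wf c \<and> wf d)"
| "wf (For x k c) = (x \<noteq> 0 \<and> k \<le> 1 \<and> x \<notin> writes c \<and> wf c)"

lemma put_apply:
  "put M a i v a = (M a)(i := v)"
  "b \<noteq> a \<Longrightarrow> put M a i v b = M b"
  by (simp_all add: put_def)

lemma sem_frame: "a \<notin> writes c \<Longrightarrow> sem c M a = M a"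
proof (induction c arbitrary: M)
  case (For x k c)
  have "((\<lambda>N. put (sem c N) x 0 (sem c N x 0 + 1)) ^^ i) N a = N a" for i N
    using For by (induction i) (auto simp: put_apply)
  then show ?case using For.prems by (simp add: put_apply)
qed (auto simp: put_apply)

lemma wf_writes: "wf c \<Longrightarrow> 0 \<notin> writes c"
  by (induction c) auto

lemma sem_input: "wf c \<Longrightarrow> sem c M 0 = M 0"
  by (simp add: sem_frame wf_writes)

text \<open>An invariant \<open>P\<close> need not mention the counter or the arrays that the loop
  leaves alone; the premise \<open>step\<close> supplies both.\<close>

lemma sem_For_induct:
  assumes wf: "wf (For x k c)"
    and init: "P 0 (put M x 0 0)"
    and step: "\<And>i N. \<lbrakk>i < M 0 k; P i N; N x 0 = i; \<And>a. a \<notin> writes (For x k c) \<Longrightarrow> N a = M a\<rbrakk>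
      \<Longrightarrow> P (Suc i) (put (sem c N) x 0 (Suc i))"
  shows "P (M 0 k) (sem (For x k c) M)"
proof -
  let ?f = "\<lambda>N. put (sem c N) x 0 (sem c N x 0 + 1)"
  have "P i ((?f ^^ i) (put M x 0 0)) \<and> (?f ^^ i) (put M x 0 0) x 0 = i
      \<and> (\<forall>a. a \<notin> writes (For x k c) \<longrightarrow> (?f ^^ i) (put M x 0 0) a = M a)" if "i \<le> M 0 k" for i
    using that
  proof (induction i)
    case 0
    have "P 0 ((?f ^^ 0) (put M x 0 0))" using init by simp
    moreover have "(?f ^^ 0) (put M x 0 0) x 0 = 0"
      "\<forall>a. a \<notin> writes (For x k c) \<longrightarrow> (?f ^^ 0) (put M x 0 0) a = M a"
      by (auto simp: put_apply)
    ultimately show ?case by blast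
  next
    case (Suc i)
    let ?N = "(?f ^^ i) (put M x 0 0)"
    have x: "sem c ?N x 0 = i"
      using Suc wf by (simp add: sem_frame)
    have "P (Suc i) (put (sem c ?N) x 0 (Suc i))"
      using Suc by (intro step) auto
    moreover have "sem c ?N a = M a" if "a \<notin> writes (For x k c)" for a
      using Suc that by (simp add: sem_frame)
    moreover have "(?f ^^ Suc i) (put M x 0 0) = put (sem c ?N) x 0 (Suc i)"
      using x by simp
    ultimately show ?case by (auto simp only:) (auto simp: put_apply)
  qed
  from this[of "M 0 k"] show ?thesis by simp
qed

section \<open>Bit lengths and costs of expressions\<close>

definition bounded :: "mem \<Rightarrow> nat \<Rightarrow> bool" where
  "bounded M B \<longleftrightarrow> (\<forall>a i. M a i < 2 ^ B)"

text \<open>One number bounds both the bit length of the value and the cost, per bit of memory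
  width. The factor 2 pays for evaluating an operand and for its length when the operation is
  charged.\<close>

fun weight :: "expr \<Rightarrow> nat" where
  "weight (Const k) = bits k + 1"
| "weight (Get a e) = 2 * weight e + 2"
| "weight (Add e f) = 2 * weight e + 2 * weight f + 1"
| "weight (Sub e f) = 2 * weight e + 2 * weight f + 1"
| "weight (Mul e f) = 2 * weight e + 2 * weight f + 1"
| "weight (Div e f) = 2 * weight e + 2 * weight f + 1"

lemma weight_pos: "0 < weight e"
  by (cases e) auto

lemma bits_le: "v < 2 ^ B \<Longrightarrow> bits v \<le> B"
  by (simp add: floorlog_le_iff)

lemma less_bits: "v < 2 ^ bits v"
proof (cases "v = 0")
  case False
  then show ?thesis using floorlog_bounds[of v 2] by simp
qed simp

lemma add_less_two_power:
  assumes "x < 2 ^ a" "y < 2 ^ b" "0 < a" "0 < b"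
  shows "x + y < (2::nat) ^ (a + b)"
proof -
  have "x + y \<le> (x + 1) * (y + 1) - 1" by simp
  moreover have "(x + 1) * (y + 1) \<le> 2 ^ a * 2 ^ b"
    using assms by (intro mult_mono) auto
  ultimately show ?thesis using assms by (simp add: power_add)
qed

lemma mult_less_two_power:
  assumes "x < 2 ^ a" "y < 2 ^ b"
  shows "x * y < (2::nat) ^ (a + b)"
  using mult_strict_mono'[OF assms] by (simp add: power_add)

text \<open>Used for arbitrary expressions in a bounded memory and for static ones when only the
  input is bounded. \<open>P\<close> is not passed on to the address inside a \<open>Get\<close>,
  whose size does not affect the cell that is read.\<close>

lemma val_less:
  assumes "0 < B"
    and "\<And>a e'. P (Get a e') \<Longrightarrow> M a (val e' M) < 2 ^ B"
    and "\<And>e f. P (Add e f) \<or> P (Sub e f) \<or> P (Mul e f) \<or> P (Div e f) \<Longrightarrow> P e \<and> P f"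
    and "P e"
  shows "val e M < 2 ^ (weight e * B)"
  using assms(4)
proof (induction e)
  case (Const k)
  have "k < 2 ^ bits k" by (rule less_bits)
  also have "\<dots> \<le> (2::nat) ^ (weight (Const k) * B)"
    using assms(1) by (intro power_increasing) (cases B, auto)
  finally show ?case by simp
next
  case (Get a e)
  have "M a (val e M) < 2 ^ B" using assms(2) Get by simp
  also have "\<dots> \<le> 2 ^ (weight (Get a e) * B)"
    by (intro power_increasing) auto
  finally show ?case by simp
next
  case (Add e f)
  then have "val e M < 2 ^ (weight e * B)" "val f M < 2 ^ (weight f * B)"
    using assms(3) by blast+
  then have "val (Add e f) M < 2 ^ (weight e * B + weight f * B)"
    using assms(1) weight_pos by (simp add: add_less_two_power)
  also have "\<dots> \<le> 2 ^ (weight (Add e f) * B)"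
    by (intro power_increasing) (auto simp: algebra_simps)
  finally show ?case .
next
  case (Sub e f)
  then have "val e M < 2 ^ (weight e * B)"
    using assms(3) by blast
  also have "\<dots> \<le> 2 ^ (weight (Sub e f) * B)"
    by (intro power_increasing) (auto simp: algebra_simps)
  finally show ?case by simp
next
  case (Mul e f)
  then have "val e M < 2 ^ (weight e * B)" "val f M < 2 ^ (weight f * B)"
    using assms(3) by blast+
  then have "val (Mul e f) M < 2 ^ (weight e * B + weight f * B)"
    by (simp add: mult_less_two_power)
  also have "\<dots> \<le> 2 ^ (weight (Mul e f) * B)"
    by (intro power_increasing) (auto simp: algebra_simps)
  finally show ?case .
next
  case (Div e f)
  then have "val e M < 2 ^ (weight e * B)"
    using assms(3) by blast
  then have "val (Div e f) M < 2 ^ (weight e * B)"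
    using div_le_dividend le_less_trans by (metis val.simps(6))
  also have "\<dots> \<le> 2 ^ (weight (Div e f) * B)"
    by (intro power_increasing) (auto simp: algebra_simps)
  finally show ?case .
qed

lemma val_bounded: "bounded M B \<Longrightarrow> 0 < B \<Longrightarrow> val e M < 2 ^ (weight e * B)"
  by (rule val_less[where P = "\<lambda>_. True"]) (auto simp: bounded_def)

lemma val_static: "static e \<Longrightarrow> \<forall>i. M 0 i < 2 ^ S \<Longrightarrow> 0 < S \<Longrightarrow> val e M < 2 ^ (weight e * S)"
  by (rule val_less[where P = static]) auto

lemma bits_val: "bounded M B \<Longrightarrow> 0 < B \<Longrightarrow> bits (val e M) \<le> weight e * B"
  by (intro bits_le val_bounded)

lemma cost_bounded:
  assumes "bounded M B" "0 < B"
  shows "cost e M \<le> weight e * B"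
proof (induction e)
  case (Const k)
  show ?case using assms(2) by (cases B) auto
next
  case (Get a e)
  moreover have "bits (M a (val e M)) \<le> B"
    using assms by (intro bits_le) (auto simp: bounded_def)
  ultimately show ?case using bits_val[OF assms, of e] assms(2) by (simp add: algebra_simps)
next
  case (Add e f)
  then show ?case using bits_val[OF assms, of e] bits_val[OF assms, of f] assms(2)
    by (simp add: algebra_simps)
next
  case (Sub e f)
  then show ?case using bits_val[OF assms, of e] bits_val[OF assms, of f] assms(2)
    by (simp add: algebra_simps)
next
  case (Mul e f)
  then show ?case using bits_val[OF assms, of e] bits_val[OF assms, of f] assms(2)
    by (simp add: algebra_simps)
next
  case (Div e f)
  then show ?case using bits_val[OF assms, of e] bits_val[OF assms, of f] assms(2)
    by (simp add: algebra_simps)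
qed

text \<open>The static summand has at most \<open>weight e * S \<le> B\<close> bits, so the worst
  case is a sum of two numbers below \<open>2 ^ B\<close>.\<close>

lemma val_slow:
  assumes "slow e" "bounded M B" "\<forall>i. M 0 i < 2 ^ S" "0 < S" "weight e * S \<le> B"
  shows "val e M < 2 ^ Suc B"
  using assms(1)
proof (cases e rule: slow.cases)
  case (1 k)
  have "val e M < 2 ^ (weight e * S)" by (rule val_static) (use 1 assms in auto)
  also have "\<dots> \<le> 2 ^ Suc B" using assms by (intro power_increasing) auto
  finally show ?thesis .
next
  case (2 a e)
  have "M a (val e M) < 2 ^ B" using assms by (simp add: bounded_def)
  then show ?thesis using 2 by simp
next
  case (3 a i f)
  have "weight f * S \<le> weight e * S" using 3 by (intro mult_right_mono) auto
  then have "weight f * S \<le> B" using assms(5) by (rule le_trans)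
  have "val f M < 2 ^ (weight f * S)" by (rule val_static) (use 3 assms in auto)
  also have "\<dots> \<le> 2 ^ B" using \<open>weight f * S \<le> B\<close> by (intro power_increasing) auto
  finally have "val f M < 2 ^ B" .
  moreover have "M a (val i M) < 2 ^ B" using assms by (simp add: bounded_def)
  ultimately show ?thesis using 3 by simp
qed auto

section \<open>Costs of programs\<close>

primrec pweight :: "prog \<Rightarrow> nat" where
  "pweight Nop = 1"
| "pweight (Assign a e f) = 2 * weight e + 2 * weight f + 1"
| "pweight (c ;; d) = pweight c + pweight d"
| "pweight (IfElse e c d) = weight e + 1 + pweight c + pweight d"
| "pweight (For x k c) = pweight c + weight (Sub (Get 0 (Const k)) (var x)) + 1
     + (2 * weight (Const 0) + 2 * weight (Add (var x) (Const 1)) + 1)"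

text \<open>The indeterminate stands for the input size, which bounds the iterations. Each iteration
  pays 2 for the test and the increment; the final 2 is for resetting the counter and for the
  failing test.\<close>

primrec steps :: "prog \<Rightarrow> nat poly" where
  "steps Nop = 1"
| "steps (Assign a e f) = 1"
| "steps (c ;; d) = steps c + steps d"
| "steps (IfElse e c d) = steps c + steps d + 1"
| "steps (For x k c) = (steps c + 2) * [:0, 1:] + 2"

lemma bounded_mono: "bounded M B \<Longrightarrow> B \<le> B' \<Longrightarrow> bounded M B'"
  unfolding bounded_def by (meson le_trans less_le_trans one_le_numeral power_increasing)

lemma bounded_put: "bounded M B \<Longrightarrow> v < 2 ^ B \<Longrightarrow> bounded (put M a i v) B"
  by (auto simp: bounded_def put_def)

lemma put_cost:
  assumes "bounded M B" "0 < B" "2 * weight e + 2 * weight f + 1 \<le> K"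
  shows "cost e M + cost f M + 1 + bits (val e M) + bits (val f M) \<le> K * B"
proof -
  have "cost e M + cost f M + 1 + bits (val e M) + bits (val f M)
      \<le> (2 * weight e + 2 * weight f + 1) * B"
    using cost_bounded[OF assms(1,2), of e] cost_bounded[OF assms(1,2), of f]
      bits_val[OF assms(1,2), of e] bits_val[OF assms(1,2), of f] assms(2)
    by (simp add: algebra_simps)
  also have "\<dots> \<le> K * B" using assms by (intro mult_right_mono) auto
  finally show ?thesis .
qed

lemma cond_cost:
  assumes "bounded M B" "0 < B" "weight e + 1 \<le> K"
  shows "cost e M + 1 \<le> K * B"
proof -
  have "cost e M + 1 \<le> (weight e + 1) * B"
    using cost_bounded[OF assms(1,2), of e] assms(2) by (simp add: algebra_simps)
  also have "\<dots> \<le> K * B" using assms by (intro mult_right_mono) auto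
  finally show ?thesis .
qed

text \<open>By \<open>slow\<close>, a stored value exceeds the values in memory by at most one bit. Hence the number
  of steps bounds the bit lengths, too, and the cost is polynomial in the number of steps.\<close>

definition runs :: "nat \<Rightarrow> com \<Rightarrow> mem \<Rightarrow> mem \<Rightarrow> nat \<Rightarrow> nat \<Rightarrow> bool" where
  "runs K c M N B s \<longleftrightarrow> bounded N (B + s) \<and>
     (\<exists>t \<le> K * s * (B + s). \<forall>rs. exec c M rs t N rs)"

lemma runs_mono:
  assumes "runs K c M N B s" "s \<le> s'" shows "runs K c M N B s'"
proof -
  have "K * s * (B + s) \<le> K * s' * (B + s')"
    using assms by (intro mult_mono) auto
  then show ?thesis using assms unfolding runs_def
    by (meson add_le_cancel_left bounded_mono le_trans)
qed

lemma runs_Seq: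
  assumes "runs K c M N B s" "runs K d N N' (B + s) s'"
  shows "runs K (Seq c d) M N' B (s + s')"
proof -
  obtain t t' where t: "t \<le> K * s * (B + s)" "\<And>rs. exec c M rs t N rs"
    "t' \<le> K * s' * (B + s + s')" "\<And>rs. exec d N rs t' N' rs"
    using assms unfolding runs_def by blast
  have "K * s * (B + s) \<le> K * s * (B + (s + s'))"
    by (intro mult_left_mono) auto
  then have "t + t' \<le> K * (s + s') * (B + (s + s'))"
    using t by (simp add: algebra_simps)
  then show ?thesis
    using assms t exec.Seq unfolding runs_def by (metis (no_types, lifting) add.assoc)
qed

lemma runs_Put:
  assumes "bounded M B" "0 < B" "val f M < 2 ^ Suc B" "2 * weight e + 2 * weight f + 1 \<le> K"
  shows "runs K (Put a e f) M (put M a (val e M) (val f M)) B 1"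
proof -
  have "bounded M (Suc B)" using assms(1) by (rule bounded_mono) simp
  then have "bounded (put M a (val e M) (val f M)) (B + 1)"
    using assms by (auto intro: bounded_put)
  moreover have "K * B \<le> K * 1 * (B + 1)" by simp
  ultimately show ?thesis
    using put_cost[OF assms(1,2,4)] exec.Put unfolding runs_def by (meson le_trans)
qed

text \<open>The part common to conditionals and to loop tests that succeed: one more step, which
  leaves memory and coin tosses untouched.\<close>

lemma runs_prefix:
  assumes "bounded M B" "0 < B" "weight e + 1 \<le> K" "runs K c M N B s"
    and "\<And>rs t. exec c M rs t N rs \<Longrightarrow> exec d M rs (cost e M + 1 + t) N rs"
  shows "runs K d M N B (s + 1)"
proof -
  obtain t where t: "t \<le> K * s * (B + s)" "\<And>rs. exec c M rs t N rs"
    using assms unfolding runs_def by blast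
  have "cost e M + 1 + t \<le> K * B + K * s * (B + s)"
    using t cond_cost[OF assms(1-3)] by simp
  also have "\<dots> \<le> K * (s + 1) * (B + (s + 1))"
    by (simp add: algebra_simps)
  finally show ?thesis
    using assms t bounded_mono[of N "B + s" "B + (s + 1)"] unfolding runs_def by fastforce
qed

text \<open>\<open>S\<close> plays two roles: it bounds the bit lengths of the input and, as
  numbers, the loop limits. \<open>M\<close> and \<open>B\<close> are generalised because each
  command starts in the memory and with the width left by its predecessor.\<close>

lemma runs_compile:
  assumes "wf c" "pweight c \<le> K" "\<forall>i. M 0 i < 2 ^ S" "0 < S" "M 0 0 \<le> S" "M 0 1 \<le> S"
    "bounded M B" "K * S \<le> B"
  shows "runs K (compile c) M (sem c M) B (poly (steps c) S)"
  using assms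
proof (induction c arbitrary: M B)
  case Nop
  then have "0 < K * (B + 1)" by simp
  then have "1 \<le> K * (B + 1)" by linarith
  then show ?case using Nop bounded_mono[of M B "B + 1"] exec.Skip
    unfolding runs_def by (auto simp del: One_nat_def)
next
  case (Assign a e f)
  have "weight f * S \<le> K * S" using Assign.prems by (intro mult_right_mono) auto
  then have "weight f * S \<le> B" using Assign.prems(8) by (rule le_trans)
  then have "val f M < 2 ^ Suc B"
    using Assign.prems by (intro val_slow[where S = S]) auto
  moreover have "0 < B"
    using Assign.prems by (metis add_is_0 bot_nat_0.not_eq_extremum le_zero_eq mult_is_0 one_neq_zero pweight.simps(2))
  ultimately show ?case
    using Assign.prems runs_Put[of M B f e K a] by simp
next
  case (Then c d)
  have "runs K (compile c) M (sem c M) B (poly (steps c) S)"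
    using Then.prems by (intro Then.IH) auto
  moreover have "runs K (compile d) (sem c M) (sem d (sem c M)) (B + poly (steps c) S) (poly (steps d) S)"
    using Then.prems calculation by (intro Then.IH) (auto simp: sem_input runs_def)
  ultimately show ?case
    by (simp add: runs_Seq)
next
  case (IfElse e c d)
  have "0 < K" using IfElse.prems by simp
  then have B: "0 < B" using IfElse.prems
    by (metis gr0I le_zero_eq mult_is_0)
  show ?case
  proof (cases "val e M \<noteq> 0")
    case True
    have "runs K (compile c) M (sem c M) B (poly (steps c) S)"
      using IfElse.prems by (intro IfElse.IH) auto
    then have "runs K (compile (IfElse e c d)) M (sem c M) B (poly (steps c) S + 1)"
      using IfElse.prems B True exec.CondTrue by (intro runs_prefix[where e = e]) auto
    then show ?thesis using True by (auto intro: runs_mono)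
  next
    case False
    have "runs K (compile d) M (sem d M) B (poly (steps d) S)"
      using IfElse.prems by (intro IfElse.IH) auto
    then have "runs K (compile (IfElse e c d)) M (sem d M) B (poly (steps d) S + 1)"
      using IfElse.prems B False exec.CondFalse by (intro runs_prefix[where e = e]) auto
    then show ?thesis using False by (auto intro: runs_mono)
  qed
next
  case (For x k c)
  define s where "s = poly (steps c) S"
  define e where "e = Sub (Get 0 (Const k)) (var x)"
  define g where "g = Put x (Const 0) (Add (var x) (Const 1))"
  define f where "f = (\<lambda>N. put (sem c N) x 0 (sem c N x 0 + 1))"
  have "0 < K" using For.prems by simp
  then have B: "0 < B" using For.prems
    by (metis gr0I le_zero_eq mult_is_0)
  \<comment> \<open>Induction on the number \<open>r\<close> of remaining iterations, which is also
    the value of the loop condition. The width \<open>B'\<close> must vary, as it grows by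
    \<open>s + 1\<close> per iteration.\<close>
  have loop: "runs K (While e (Seq (compile c) g)) N ((f ^^ r) N) B' ((s + 2) * r + 1)"
    if "N 0 = M 0" "N x 0 + r = M 0 k" "bounded N B'" "B \<le> B'" for r N B'
    using that
  proof (induction r arbitrary: N B')
    case 0
    have "cost e N + 1 \<le> K * B'"
      using 0 B For.prems by (intro cond_cost) (auto simp: e_def)
    also have "\<dots> \<le> K * ((s + 2) * 0 + 1) * (B' + ((s + 2) * 0 + 1))" by simp
    finally have "cost e N + 1 \<le> K * ((s + 2) * 0 + 1) * (B' + ((s + 2) * 0 + 1))" .
    moreover have "exec (While e (Seq (compile c) g)) N rs (cost e N + 1) N rs" for rs
      using 0 by (intro exec.WhileFalse) (auto simp: e_def)
    ultimately show ?case
      using 0 bounded_mono[of N B' "B' + 1"] unfolding runs_def by auto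
  next
    case (Suc r)
    have pos: "0 < B'" using Suc.prems B by simp
    have 1: "runs K (compile c) N (sem c N) B' s"
      unfolding s_def using For.prems Suc.prems by (intro For.IH) auto
    have xe: "sem c N x 0 = N x 0"
      using For.prems by (simp add: sem_frame)
    have "1 < (2::nat) ^ (B' + s)" using pos by (intro one_less_power) auto
    moreover have "sem c N x 0 < 2 ^ (B' + s)"
      using 1 by (simp add: runs_def bounded_def)
    ultimately have "val (Add (var x) (Const 1)) (sem c N) < 2 ^ Suc (B' + s)"
      by simp
    then have 2: "runs K g (sem c N) (f N) (B' + s) 1"
      using 1 runs_Put[of "sem c N" "B' + s" "Add (var x) (Const 1)" "Const 0" K x] For.prems pos
      unfolding runs_def f_def g_def by auto
    have 3: "runs K (While e (Seq (compile c) g)) (f N) ((f ^^ r) (f N)) (B' + (s + 1)) ((s + 2) * r + 1)"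
      using Suc.prems For.prems 2 xe
      by (intro Suc.IH) (auto simp: f_def put_apply sem_input runs_def)
    have "runs K (Seq (Seq (compile c) g) (While e (Seq (compile c) g))) N ((f ^^ r) (f N)) B'
        ((s + 1) + ((s + 2) * r + 1))"
      using 1 2 3 by (intro runs_Seq)
    moreover have "exec (While e (Seq (compile c) g)) N rs (cost e N + 1 + t) N' rs"
      if "exec (Seq (Seq (compile c) g) (While e (Seq (compile c) g))) N rs t N' rs" for rs t N'
    proof -
      have "val e N \<noteq> 0" using Suc.prems by (simp add: e_def)
      with that show ?thesis
        by (elim SeqE[of "Seq (compile c) g"]) (metis exec.WhileTrue add.assoc)
    qed
    moreover have "weight e + 1 \<le> K" using For.prems(2) unfolding e_def pweight.simps by linarith
    ultimately have "runs K (While e (Seq (compile c) g)) N ((f ^^ r) (f N)) B'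
        ((s + 1) + ((s + 2) * r + 1) + 1)"
      using Suc.prems(3) pos by (intro runs_prefix)
    then show ?case by (simp add: funpow_swap1 algebra_simps)
  qed
  have k: "M 0 k \<le> S" using For.prems by (cases "k = 0") (auto simp: le_Suc_eq)
  have init: "runs K (Put x (Const 0) (Const 0)) M (put M x 0 0) B 1"
    using runs_Put[of M B "Const 0" "Const 0" K x] For.prems B by simp
  have "runs K (While e (Seq (compile c) g)) (put M x 0 0) ((f ^^ M 0 k) (put M x 0 0)) (B + 1)
      ((s + 2) * M 0 k + 1)"
    using init For.prems by (intro loop) (auto simp: put_apply runs_def)
  then have "runs K (Seq (Put x (Const 0) (Const 0)) (While e (Seq (compile c) g))) M
      ((f ^^ M 0 k) (put M x 0 0)) B (1 + ((s + 2) * M 0 k + 1))"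
    by (rule runs_Seq[OF init])
  moreover have "(s + 2) * M 0 k \<le> (s + 2) * S" using k by (rule mult_left_mono) simp
  ultimately have "runs K (Seq (Put x (Const 0) (Const 0)) (While e (Seq (compile c) g))) M
      ((f ^^ M 0 k) (put M x 0 0)) B ((s + 2) * S + 2)"
    by (auto elim: runs_mono)
  moreover have "poly (steps (For x k c)) S = (s + 2) * S + 2"
    by (simp add: s_def poly_numeral)
  ultimately show ?case by (simp only: e_def f_def g_def compile.simps sem.simps)
qed

lemma length_le_input_size: "length xs \<le> input_size xs"
  by (induction xs) (auto simp: input_size_def)

lemma init_mem_less: "init_mem xs a i < 2 ^ input_size xs"
proof -
  have "x < 2 ^ input_size xs" if "x \<in> set xs" for x
  proof -
    have "bits x \<le> input_size xs"
      using member_le_sum_list[of "bits x + 1" "map (\<lambda>x. bits x + 1) xs"] that by (simp add: input_size_def)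
    then show ?thesis using less_bits[of x]
      by (meson less_le_trans one_le_numeral power_increasing)
  qed
  then show ?thesis by (auto simp: init_mem_def)
qed

lemma compile_polynomial:
  assumes "wf c"
  obtains q where "\<And>xs. \<lbrakk>0 < length xs; init_mem xs 0 0 \<le> input_size xs; init_mem xs 0 1 \<le> input_size xs\<rbrakk>
    \<Longrightarrow> \<exists>t \<le> poly q (input_size xs). \<forall>rs. exec (compile c) (init_mem xs) rs t (sem c (init_mem xs)) rs"
proof
  define K where "K = pweight c + 1"
  fix xs :: "nat list"
  let ?S = "input_size xs"
  assume xs: "0 < length xs" "init_mem xs 0 0 \<le> ?S" "init_mem xs 0 1 \<le> ?S"
  have S: "0 < ?S" using xs(1) length_le_input_size[of xs] by linarith
  have "bounded (init_mem xs) ?S" by (simp add: bounded_def init_mem_less)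
  then have "bounded (init_mem xs) (K * ?S)" by (rule bounded_mono) (simp add: K_def)
  then have "runs K (compile c) (init_mem xs) (sem c (init_mem xs)) (K * ?S) (poly (steps c) ?S)"
    using assms xs S by (intro runs_compile) (auto simp: K_def init_mem_less)
  \<comment> \<open>The bound \<open>K * s * (B + s)\<close> of \<open>runs\<close>, at
    \<open>B = K * S\<close>, the width that \<open>runs_compile\<close> asks for.\<close>
  then show "\<exists>t \<le> poly ([:K:] * steps c * ([:0, K:] + steps c)) ?S.
      \<forall>rs. exec (compile c) (init_mem xs) rs t (sem c (init_mem xs)) rs"
    by (simp add: runs_def mult_ac)
qed


section \<open>The algorithm\<close>

declare sem.simps(5) [simp del] One_nat_def [simp del]

text \<open>The data of an instance, read off its encoding \<open>A\<close>. Both sides of a constraint are multiplied by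
  the denominator of the bound, so that they are integral.\<close>

definition cut :: "(nat \<Rightarrow> nat) \<Rightarrow> nat \<Rightarrow> nat \<Rightarrow> nat" where
  "cut A j k = A (2 + j * A 0 + k)"

definition gain :: "(nat \<Rightarrow> nat) \<Rightarrow> nat \<Rightarrow> nat" where
  "gain A j = A (2 + A 0 * A 0 + j)"

definition usage :: "(nat \<Rightarrow> nat) \<Rightarrow> nat \<Rightarrow> nat \<Rightarrow> nat" where
  "usage A i j = A (2 + A 0 * A 0 + A 0 + i * A 0 + j) *
     A (2 + A 0 * A 0 + A 0 + A 1 * A 0 + 2 * i + 1)"

definition budget :: "(nat \<Rightarrow> nat) \<Rightarrow> nat \<Rightarrow> nat" where
  "budget A i = A (2 + A 0 * A 0 + A 0 + A 1 * A 0 + 2 * i)"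

text \<open>The factor \<open>h\<close> expresses a fraction of the budgets without division:
  \<open>h = 2\<close> leaves half of each budget free.\<close>

definition fits :: "(nat \<Rightarrow> nat) \<Rightarrow> nat \<Rightarrow> nat set \<Rightarrow> bool" where
  "fits A h S \<longleftrightarrow> (\<forall>i<A 1. h * (\<Sum>k\<in>S. usage A i k) \<le> budget A i)"

definition obj :: "(nat \<Rightarrow> nat) \<Rightarrow> nat set \<Rightarrow> nat" where
  "obj A S = (\<Sum>j\<in>S. gain A j + (\<Sum>k\<in>S. cut A j k))"

text \<open>That is, \<open>usage A i j \<le> budget A i / (2 * sqrt n)\<close> for all \<open>i\<close>, where \<open>n = A 0\<close>.\<close>

definition light :: "(nat \<Rightarrow> nat) \<Rightarrow> nat \<Rightarrow> bool" where
  "light A j \<longleftrightarrow> (\<forall>i<A 1. 4 * A 0 * (usage A i j * usage A i j) \<le> budget A i * budget A i)"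

text \<open>What adding items to \<open>S\<close> in the order of decreasing weight \<open>w\<close>, as long as they fit, guarantees.
  Items of weight 0 may be passed over.\<close>

definition greedy :: "(nat \<Rightarrow> nat) \<Rightarrow> nat \<Rightarrow> (nat \<Rightarrow> nat) \<Rightarrow> nat set \<Rightarrow> nat set \<Rightarrow> bool" where
  "greedy A h w S T \<longleftrightarrow> S \<subseteq> T \<and> T \<subseteq> {..<A 0} \<and> fits A h T \<and>
     (\<forall>j<A 0. 0 < w j \<and> j \<notin> T \<longrightarrow> \<not> fits A h (insert j {k\<in>T. k \<in> S \<or> w j \<le> w k}))"

definition ind :: "nat set \<Rightarrow> nat \<Rightarrow> nat" where
  "ind T j = of_bool (j \<in> T)"

lemma ind_insert: "(ind T)(j := 1) = ind (insert j T)"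
  by (auto simp: ind_def)

lemma fits_mono: "fits A h T \<Longrightarrow> S \<subseteq> T \<Longrightarrow> finite T \<Longrightarrow> fits A h S"
  unfolding fits_def by (meson le_trans mult_le_mono2 sum_mono2 zero_le)

lemma sum_ind: "S \<subseteq> {..<n} \<Longrightarrow> (\<Sum>k<n. if ind S k = 0 then 0 else f k) = sum f S"
  by (rule sum.mono_neutral_cong_right) (auto simp: ind_def)

section \<open>The program text\<close>

abbreviation (input) "OUT \<equiv> 1 :: nat"
abbreviation (input) "SEL \<equiv> 2 :: nat"
abbreviation (input) "VAL \<equiv> 3 :: nat"
abbreviation (input) "LIGHT \<equiv> 4 :: nat"
abbreviation (input) "VJ \<equiv> 5 :: nat"
abbreviation (input) "VK \<equiv> 6 :: nat"
abbreviation (input) "VI \<equiv> 7 :: nat"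
abbreviation (input) "VR \<equiv> 8 :: nat"
abbreviation (input) "VV \<equiv> 9 :: nat"
abbreviation (input) "OK \<equiv> 10 :: nat"
abbreviation (input) "ACC \<equiv> 11 :: nat"
abbreviation (input) "SCALE \<equiv> 12 :: nat"
abbreviation (input) "PICK \<equiv> 13 :: nat"
abbreviation (input) "OBJ \<equiv> 14 :: nat"
abbreviation (input) "TOP \<equiv> 15 :: nat"

abbreviation assign :: "nat \<Rightarrow> expr \<Rightarrow> prog" where
  "assign a \<equiv> Assign a (Const 0)"

definition con_pos :: expr where
  "con_pos = Add (Add (Const 2) (Mul (var 0) (var 0))) (var 0)"

definition bnd_pos :: "expr \<Rightarrow> expr" where
  "bnd_pos e = Add (Add con_pos (Mul (Get 0 (Const 1)) (var 0))) (Mul (Const 2) e)"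

definition cut_expr :: "expr \<Rightarrow> expr \<Rightarrow> expr" where
  "cut_expr e f = Get 0 (Add (Add (Const 2) (Mul e (var 0))) f)"

definition gain_expr :: "expr \<Rightarrow> expr" where
  "gain_expr e = Get 0 (Add (Add (Const 2) (Mul (var 0) (var 0))) e)"

definition usage_expr :: "expr \<Rightarrow> expr \<Rightarrow> expr" where
  "usage_expr e f = Mul (Get 0 (Add (Add con_pos (Mul e (var 0))) f))
     (Get 0 (Add (bnd_pos e) (Const 1)))"

definition budget_expr :: "expr \<Rightarrow> expr" where
  "budget_expr e = Get 0 (bnd_pos e)"

lemma val_data [simp]:
  "val (cut_expr e f) M = cut (M 0) (val e M) (val f M)"
  "val (gain_expr e) M = gain (M 0) (val e M)"
  "val (usage_expr e f) M = usage (M 0) (val e M) (val f M)"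
  "val (budget_expr e) M = budget (M 0) (val e M)"
  by (simp_all add: cut_expr_def cut_def gain_expr_def gain_def usage_expr_def usage_def
    budget_expr_def budget_def con_pos_def bnd_pos_def)

lemma static_data [simp]:
  "static (cut_expr e f)" "static (gain_expr e)" "static (usage_expr e f)" "static (budget_expr e)"
  by (simp_all add: cut_expr_def gain_expr_def usage_expr_def budget_expr_def)

text \<open>Subtraction is truncated, so \<open>Sub e f\<close> as a condition means that
  \<open>e\<close> exceeds \<open>f\<close>. All comparisons below are made in this way.\<close>

definition check :: prog where
  "check =
     assign OK (Const 1) ;;
     For VI 1 (
       assign ACC (Const 0) ;;
       For VK 0 (IfElse (Get SEL (var VK)) (assign ACC (Add (var ACC) (usage_expr (var VI) (var VK)))) Nop) ;;
       IfElse (Sub (Mul (var SCALE) (var ACC)) (budget_expr (var VI))) (assign OK (Const 0)) Nop)"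

definition attempt :: prog where
  "attempt =
     Assign SEL (var PICK) (Const 1) ;; check ;;
     IfElse (var OK) Nop (Assign SEL (var PICK) (Const 0))"

definition pick :: prog where
  "pick =
     assign PICK (Const 0) ;;
     For VJ 0 (IfElse (Sub (Get VAL (var VJ)) (Get VAL (var PICK))) (assign PICK (var VJ)) Nop)"

definition fill :: prog where
  "fill = For VR 0 (pick ;; Assign VAL (var PICK) (Const 0) ;; attempt)"

definition submit :: prog where
  "submit =
     assign OBJ (Const 0) ;;
     For VJ 0 (IfElse (Get SEL (var VJ))
       (assign OBJ (Add (var OBJ) (gain_expr (var VJ))) ;;
        For VK 0 (IfElse (Get SEL (var VK)) (assign OBJ (Add (var OBJ) (cut_expr (var VJ) (var VK)))) Nop))
       Nop) ;;
     IfElse (Sub (var OBJ) (var TOP))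
       (assign TOP (var OBJ) ;; For VJ 0 (Assign OUT (var VJ) (Get SEL (var VJ))))
       Nop"

definition clear :: prog where
  "clear = For VJ 0 (Assign SEL (var VJ) (Const 0))"

definition star :: prog where
  "star =
     For VJ 0 (Assign VAL (var VJ) (Add (cut_expr (var VV) (var VJ)) (gain_expr (var VJ)))) ;;
     clear ;; assign SCALE (Const 1) ;; assign PICK (var VV) ;; attempt ;; fill ;; submit"

definition mark_light :: prog where
  "mark_light = For VJ 0 (
     Assign LIGHT (var VJ) (Const 1) ;;
     For VI 1 (IfElse (Sub (Mul (Mul (Const 4) (var 0))
           (Mul (usage_expr (var VI) (var VJ)) (usage_expr (var VI) (var VJ))))
         (Mul (budget_expr (var VI)) (budget_expr (var VI))))
       (Assign LIGHT (var VJ) (Const 0)) Nop))"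

definition degrees :: "nat \<Rightarrow> prog" where
  "degrees L = For VJ 0 (
     Assign VAL (var VJ) (Const 0) ;;
     For VK 0 (IfElse (Get L (var VK))
       (Assign VAL (var VJ) (Add (Get VAL (var VJ)) (cut_expr (var VJ) (var VK)))) Nop))"

text \<open>Weight 0 removes heavy items from the comparison in the second phase, whose counting
  argument needs every item of positive weight to be light.\<close>

definition drop_heavy :: prog where
  "drop_heavy = For VJ 0 (IfElse (Get LIGHT (var VJ)) Nop (Assign VAL (var VJ) (Const 0)))"

definition dense :: prog where
  "dense =
     mark_light ;; degrees LIGHT ;; clear ;; assign SCALE (Const 2) ;; fill ;;
     degrees SEL ;; drop_heavy ;; assign SCALE (Const 1) ;; fill ;; submit"

definition piqp_prog :: prog where
  "piqp_prog = For VV 0 star ;; dense"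

lemma writes_progs [simp]:
  "writes check = {OK, VI, ACC, VK}"
  "writes attempt = {SEL, OK, VI, ACC, VK}"
  "writes pick = {PICK, VJ}"
  "writes fill = {VR, PICK, VJ, VAL, SEL, OK, VI, ACC, VK}"
  "writes submit = {OBJ, VJ, VK, TOP, OUT}"
  "writes clear = {VJ, SEL}"
  "writes mark_light = {VJ, LIGHT, VI}"
  "writes (degrees L) = {VJ, VAL, VK}"
  "writes drop_heavy = {VJ, VAL}"
  by (auto simp: check_def attempt_def pick_def fill_def submit_def clear_def mark_light_def
    degrees_def drop_heavy_def)

lemma writes_star [simp]: "writes star = {VJ, VAL, SEL, SCALE, PICK, OK, VI, ACC, VK, VR, OBJ, TOP, OUT}"
  by (auto simp: star_def)

lemma wf_progs [simp]:
  "wf check" "wf attempt" "wf pick" "wf fill" "wf submit" "wf clear" "wf mark_light"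
  "wf (degrees L)" "wf drop_heavy"
proof -
  show 1: "wf check" by (simp add: check_def)
  then show 2: "wf attempt" by (simp add: attempt_def)
  show 3: "wf pick" by (simp add: pick_def)
  show "wf fill" using 2 3 by (simp add: fill_def)
  show "wf submit" "wf clear" "wf mark_light" "wf (degrees L)" "wf drop_heavy"
    by (simp_all add: submit_def clear_def mark_light_def degrees_def drop_heavy_def)
qed

lemma wf_star [simp]: "wf star"
  \<comment> \<open>\<open>slow\<close> must see the leading \<open>Get\<close> of the sum, which
    \<open>cut_expr\<close> hides.\<close>
  by (simp add: star_def, simp add: cut_expr_def)

lemma wf_piqp_prog: "wf piqp_prog"
  by (simp add: piqp_prog_def dense_def)

section \<open>Rules for summing, flag-clearing and array-filling loops\<close>

lemma sum_loop:
  assumes "wf (For x k c)" "a \<noteq> x"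
    and "\<And>i N. \<lbrakk>i < M 0 k; N x 0 = i; \<And>b. b \<notin> writes (For x k c) \<Longrightarrow> N b = M b\<rbrakk>
      \<Longrightarrow> sem c N a j = N a j + F i"
  shows "sem (For x k c) M a j = M a j + (\<Sum>i<M 0 k. F i)"
  using assms(1)
  by (rule sem_For_induct[where P = "\<lambda>i N. N a j = M a j + (\<Sum>i<i. F i)"])
    (use assms in \<open>auto simp: put_apply\<close>)

lemma flag_loop:
  assumes "wf (For x k c)" "a \<noteq> x"
    and "\<And>i N. \<lbrakk>i < M 0 k; N x 0 = i; \<And>b. b \<notin> writes (For x k c) \<Longrightarrow> N b = M b\<rbrakk>
      \<Longrightarrow> sem c N a j = (if Q i then N a j else 0)"
  shows "sem (For x k c) M a j = (if \<forall>i<M 0 k. Q i then M a j else 0)"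
  using assms(1)
  by (rule sem_For_induct[where P = "\<lambda>i N. N a j = (if \<forall>l<i. Q l then M a j else 0)"])
    (use assms in \<open>auto simp: put_apply less_Suc_eq\<close>)

lemma array_loop:
  assumes "wf (For x k c)" "a \<noteq> x"
    and "\<And>i N. \<lbrakk>i < M 0 k; N x 0 = i; N a i = M a i; \<And>b. b \<notin> writes (For x k c) \<Longrightarrow> N b = M b\<rbrakk>
      \<Longrightarrow> sem c N a i = F i"
    and "\<And>i l N. \<lbrakk>N x 0 = i; l \<noteq> i\<rbrakk> \<Longrightarrow> sem c N a l = N a l"
  shows "sem (For x k c) M a = (\<lambda>j. if j < M 0 k then F j else M a j)"
  using assms(1)
proof (rule sem_For_induct[where P = "\<lambda>i N. N a = (\<lambda>j. if j < i then F j else M a j)"], goal_cases)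
  case 1
  then show ?case using assms(2) by (simp add: put_apply)
next
  case (2 i N)
  then have "sem c N a j = (if j < Suc i then F j else M a j)" for j
    using assms(3)[of i N] assms(4)[of N i j] by (cases "j = i") auto
  then show ?case using assms(2) by (auto simp: put_apply)
qed

section \<open>Effects of the subprograms\<close>

lemma sem_check:
  assumes "M SEL = ind T" "T \<subseteq> {..<M 0 0}"
  shows "sem check M OK 0 = of_bool (fits (M 0) (M SCALE 0) T)"
proof -
  define c where "c = IfElse (Get SEL (var VK)) (assign ACC (Add (var ACC) (usage_expr (var VI) (var VK)))) Nop"
  have sum: "sem (For VK 0 c) N ACC 0 = N ACC 0 + (\<Sum>k\<in>T. usage (M 0) (N VI 0) k)"
    if "N SEL = M SEL" "N 0 = M 0" for N
  proof -
    have "sem (For VK 0 c) N ACC 0 = N ACC 0 +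
      (\<Sum>k<N 0 0. if ind T k = 0 then 0 else usage (M 0) (N VI 0) k)"
      by (rule sum_loop) (use assms(1) that in \<open>auto simp: c_def put_apply\<close>)
    then show ?thesis using sum_ind[OF assms(2)] that by simp
  qed
  have frame: "sem (For VK 0 c) N b = N b" if "b \<notin> {VK, ACC}" for N b
    using that by (intro sem_frame) (auto simp: c_def)
  have c: "wf c" "writes c = {ACC}" by (simp_all add: c_def)
  show ?thesis
    unfolding check_def sem.simps(3) unfolding c_def[symmetric]
  proof (subst flag_loop[where Q = "\<lambda>i. M SCALE 0 * (\<Sum>k\<in>T. usage (M 0) i k) \<le> budget (M 0) i"], goal_cases)
    case (3 i N)
    then have N: "N SEL = M SEL" "N 0 = M 0" "N SCALE = M SCALE" by (simp_all add: c put_apply)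
    show ?case using 3(2) by (simp add: sum frame put_apply N)
  qed (auto simp: c put_apply fits_def)
qed

lemma sem_attempt:
  assumes "M SEL = ind T" "T \<subseteq> {..<M 0 0}" "M PICK 0 < M 0 0" "fits (M 0) (M SCALE 0) T"
  shows "sem attempt M SEL = ind (if fits (M 0) (M SCALE 0) (insert (M PICK 0) T)
    then insert (M PICK 0) T else T)"
proof -
  define N where "N = put M SEL (M PICK 0) 1"
  have N: "N SEL = ind (insert (M PICK 0) T)" "N 0 = M 0" "N SCALE = M SCALE" "N PICK = M PICK"
    using assms(1) ind_insert by (auto simp: N_def put_apply)
  have "sem check N OK 0 = of_bool (fits (M 0) (M SCALE 0) (insert (M PICK 0) T))"
    using sem_check[of N "insert (M PICK 0) T"] assms N by simp
  moreover have "sem check N b = N b" if "b \<in> {SEL, PICK}" for b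
    using that by (intro sem_frame) auto
  moreover have "sem attempt M = sem (IfElse (var OK) Nop (Assign SEL (var PICK) (Const 0))) (sem check N)"
    by (simp add: attempt_def N_def)
  moreover have "(ind (insert (M PICK 0) T))(M PICK 0 := 0) = ind T" if "M PICK 0 \<notin> T"
    using that by (auto simp: ind_def)
  \<comment> \<open>A failed check clears the cell of the item, which would be wrong for an item
    already in \<open>T\<close>. This cannot happen: inserting it leaves \<open>T\<close> unchanged,
    and \<open>T\<close> fits.\<close>
  moreover have "M PICK 0 \<notin> T" if "\<not> fits (M 0) (M SCALE 0) (insert (M PICK 0) T)"
    using that assms(4) by (auto simp: insert_absorb)
  ultimately show ?thesis using N by (auto simp: put_apply)
qed

lemma sem_pick:
  assumes "0 < M 0 0"
  shows "sem pick M PICK 0 < M 0 0" "j < M 0 0 \<Longrightarrow> M VAL j \<le> M VAL (sem pick M PICK 0)"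
proof -
  define N where "N = put M PICK 0 0"
  define c where "c = IfElse (Sub (Get VAL (var VJ)) (Get VAL (var PICK))) (assign PICK (var VJ)) Nop"
  have "sem (For VJ 0 c) N PICK 0 < N 0 0 \<and>
      (\<forall>j<N 0 0. M VAL j \<le> M VAL (sem (For VJ 0 c) N PICK 0))"
    by (rule sem_For_induct[where P = "\<lambda>i N'. N' PICK 0 < N 0 0 \<and>
        (\<forall>j<i. M VAL j \<le> M VAL (N' PICK 0))"])
      (use assms in \<open>auto simp: c_def N_def put_apply less_Suc_eq intro: order.trans\<close>)
  then show "sem pick M PICK 0 < M 0 0"
    "j < M 0 0 \<Longrightarrow> M VAL j \<le> M VAL (sem pick M PICK 0)"
    by (simp_all add: pick_def c_def N_def put_apply)
qed

text \<open>When \<open>b\<close> is rejected with its weight still intact, all items added so far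
  weigh at least as much, so \<open>T\<close> is exactly the set that \<open>greedy\<close> speaks
  of. Later additions only enlarge that set, so the rejection stays justified.\<close>

lemma sem_fill:
  assumes "M SEL = ind S" "S \<subseteq> {..<M 0 0}" "fits (M 0) (M SCALE 0) S"
  obtains T where "sem fill M SEL = ind T" "greedy (M 0) (M SCALE 0) (M VAL) S T"
proof -
  define A where "A = M 0"
  define h where "h = M SCALE 0"
  define w where "w = M VAL"
  define c where "c = pick ;; Assign VAL (var PICK) (Const 0) ;; attempt"
  \<comment> \<open>Value 0 marks a treated item. By the \<open>card\<close> clause, each round
    consumes a nonzero value as long as there is one, so \<open>n\<close> rounds treat all items of
    positive weight.\<close>
  define P where "P = (\<lambda>i N. \<exists>T. N SEL = ind T \<and> S \<subseteq> T \<and> T \<subseteq> {..<A 0} \<and> fits A h T \<and>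
    (\<forall>j<A 0. N VAL j = w j \<or> N VAL j = 0) \<and> (\<forall>k\<in>T - S. \<forall>j<A 0. N VAL j \<le> w k) \<and>
    (\<forall>j<A 0. 0 < w j \<and> j \<notin> T \<and> N VAL j = 0 \<longrightarrow>
      \<not> fits A h (insert j {k\<in>T. k \<in> S \<or> w j \<le> w k})) \<and>
    card {j. j < A 0 \<and> N VAL j \<noteq> 0} + i \<le> A 0)"
  have "P (M 0 0) (sem (For VR 0 c) M)"
  proof (rule sem_For_induct)
    show "wf (For VR 0 c)" by (simp add: c_def)
    have "card {j. j < A 0 \<and> w j \<noteq> 0} \<le> card {..<A 0}"
      by (intro card_mono) auto
    then show "P 0 (put M VR 0 0)"
      unfolding P_def by (intro exI[of _ S])
        (use assms in \<open>auto simp: put_apply A_def h_def w_def\<close>)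
  next
    fix i N
    assume i: "i < M 0 0" and P: "P i N"
      and frame: "\<And>a. a \<notin> writes (For VR 0 c) \<Longrightarrow> N a = M a"
    have N0: "N 0 = A" "N SCALE 0 = h" by (simp_all add: frame c_def A_def h_def)
    from P obtain T where T: "N SEL = ind T" "S \<subseteq> T" "T \<subseteq> {..<A 0}" "fits A h T"
      and same: "\<And>j. j < A 0 \<Longrightarrow> N VAL j = w j \<or> N VAL j = 0"
      and above: "\<And>k j. k \<in> T - S \<Longrightarrow> j < A 0 \<Longrightarrow> N VAL j \<le> w k"
      and rej: "\<And>j. \<lbrakk>j < A 0; 0 < w j; j \<notin> T; N VAL j = 0\<rbrakk> \<Longrightarrow>
        \<not> fits A h (insert j {k\<in>T. k \<in> S \<or> w j \<le> w k})"
      and card: "card {j. j < A 0 \<and> N VAL j \<noteq> 0} + i \<le> A 0"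
      unfolding P_def by auto
    define b where "b = sem pick N PICK 0"
    have b: "b < A 0" "\<And>j. j < A 0 \<Longrightarrow> N VAL j \<le> N VAL b"
      using sem_pick[of N] i N0 unfolding b_def A_def by auto
    define N1 where "N1 = put (sem pick N) VAL b 0"
    have N1: "N1 0 = A" "N1 SCALE 0 = h" "N1 PICK 0 = b" "N1 SEL = ind T" "N1 VAL = (N VAL)(b := 0)"
      using N0 T by (auto simp: N1_def put_apply sem_frame b_def)
    define T' where "T' = (if fits A h (insert b T) then insert b T else T)"
    have X: "sem c N SEL = ind T'"
      using sem_attempt[of N1 T] N1 T b by (simp add: c_def T'_def N1_def b_def)
    have Y: "sem c N VAL = (N VAL)(b := 0)"
      by (simp add: c_def b_def sem_frame put_apply fun_eq_iff)
    have fin: "finite T'" using T(3) finite_subset[OF T(3)] by (auto simp: T'_def)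
    have TT: "T \<subseteq> T'" "T' \<subseteq> insert b T" by (auto simp: T'_def)
    have wb: "N VAL b \<le> w b" using same[OF b(1)] by auto
    have rej': "\<not> fits A h (insert j {k\<in>T'. k \<in> S \<or> w j \<le> w k})"
      if j: "j < A 0" "0 < w j" "j \<notin> T'" "((N VAL)(b := 0)) j = 0" for j
    proof (cases "N VAL j = 0")
      case True
      have "\<not> fits A h (insert j {k\<in>T. k \<in> S \<or> w j \<le> w k})"
        using True j TT by (intro rej) auto
      then show ?thesis
        using fits_mono[of A h "insert j {k\<in>T'. k \<in> S \<or> w j \<le> w k}"
          "insert j {k\<in>T. k \<in> S \<or> w j \<le> w k}"] fin TT by auto
    next
      case False
      then have jb: "j = b" "N VAL b = w b" using j same[of j] by (auto split: if_splits)
      then have "\<not> fits A h (insert b T)" using j by (auto simp: T'_def split: if_splits)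
      moreover have "T \<subseteq> {k\<in>T'. k \<in> S \<or> w j \<le> w k}"
        using above[of _ b] jb b(1) TT by auto
      ultimately show ?thesis
        using fits_mono[of A h "insert j {k\<in>T'. k \<in> S \<or> w j \<le> w k}" "insert b T"] fin jb by auto
    qed
    have above': "((N VAL)(b := 0)) j \<le> w k" if k: "k \<in> T' - S" "j < A 0" for j k
    proof (cases "k = b")
      case True
      then show ?thesis using b(2)[of j] wb k by auto
    next
      case False
      then show ?thesis using above[of k j] k TT by auto
    qed
    have card': "card {j. j < A 0 \<and> ((N VAL)(b := 0)) j \<noteq> 0} + Suc i \<le> A 0"
    proof (cases "N VAL b = 0")
      case True
      then have "{j. j < A 0 \<and> ((N VAL)(b := 0)) j \<noteq> 0} = {}" using b(2) by auto
      then show ?thesis using i by (simp only: A_def) simp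
    next
      case False
      then have "{j. j < A 0 \<and> ((N VAL)(b := 0)) j \<noteq> 0} = {j. j < A 0 \<and> N VAL j \<noteq> 0} - {b}"
        and bin: "b \<in> {j. j < A 0 \<and> N VAL j \<noteq> 0}"
        using b(1) by auto
      then have "card {j. j < A 0 \<and> ((N VAL)(b := 0)) j \<noteq> 0} = card {j. j < A 0 \<and> N VAL j \<noteq> 0} - 1"
        by (simp add: card_Diff_singleton)
      moreover have "0 < card {j. j < A 0 \<and> N VAL j \<noteq> 0}"
        using bin by (auto simp: card_gt_0_iff)
      ultimately show ?thesis using card by simp
    qed
    show "P (Suc i) (put (sem c N) VR 0 (Suc i))"
      unfolding P_def
    proof (intro exI[of _ T'] conjI)
      show "T' \<subseteq> {..<A 0}" using T b by (auto simp: T'_def)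
      show "fits A h T'" using T by (simp add: T'_def)
    qed (use X Y T TT same rej' above' card' in \<open>auto simp: put_apply\<close>)
  qed
  then obtain T where T: "sem fill M SEL = ind T" "S \<subseteq> T" "T \<subseteq> {..<A 0}" "fits A h T"
    and rej: "\<And>j. \<lbrakk>j < A 0; 0 < w j; j \<notin> T; sem fill M VAL j = 0\<rbrakk> \<Longrightarrow>
        \<not> fits A h (insert j {k\<in>T. k \<in> S \<or> w j \<le> w k})"
    and "card {j. j < A 0 \<and> sem fill M VAL j \<noteq> 0} = 0"
    unfolding P_def fill_def c_def[symmetric] A_def[symmetric] by auto
  then have "sem fill M VAL j = 0" if "j < A 0" for j
    using that by auto
  with T rej have "greedy A h w S T" by (auto simp: greedy_def)
  then show ?thesis using T that by (simp add: A_def h_def w_def)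
qed

text \<open>The invariant between calls of \<open>submit\<close>. The initial memory satisfies it
  with the empty set, whose objective is 0.\<close>

definition best :: "mem \<Rightarrow> nat set \<Rightarrow> bool" where
  "best M T \<longleftrightarrow> M OUT = ind T \<and> T \<subseteq> {..<M 0 0} \<and> fits (M 0) 1 T \<and> M TOP 0 = obj (M 0) T"

lemma sem_submit:
  assumes "M SEL = ind T" "T \<subseteq> {..<M 0 0}" "fits (M 0) 1 T" "best M T'"
  obtains S where "best (sem submit M) S" "obj (M 0) T \<le> obj (M 0) S" "obj (M 0) T' \<le> obj (M 0) S"
proof -
  define c where "c = IfElse (Get SEL (var VK)) (assign OBJ (Add (var OBJ) (cut_expr (var VJ) (var VK)))) Nop"
  define d where "d = IfElse (Get SEL (var VJ)) (assign OBJ (Add (var OBJ) (gain_expr (var VJ))) ;; For VK 0 c) Nop"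
  define N where "N = sem (For VJ 0 d) (put M OBJ 0 0)"
  have sum: "sem (For VK 0 c) N OBJ 0 = N OBJ 0 + (\<Sum>k\<in>T. cut (M 0) (N VJ 0) k)"
    if "N SEL = M SEL" "N 0 = M 0" for N
  proof -
    have "sem (For VK 0 c) N OBJ 0 = N OBJ 0 +
      (\<Sum>k<N 0 0. if ind T k = 0 then 0 else cut (M 0) (N VJ 0) k)"
      by (rule sum_loop) (use assms(1) that in \<open>auto simp: c_def put_apply\<close>)
    then show ?thesis using sum_ind[OF assms(2)] that by simp
  qed
  have "N OBJ 0 = put M OBJ 0 0 OBJ 0 + (\<Sum>j<put M OBJ 0 0 0 0. if ind T j = 0 then 0 else
      gain (M 0) j + (\<Sum>k\<in>T. cut (M 0) j k))"
    unfolding N_def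
  proof (rule sum_loop, goal_cases)
    case (3 i N)
    then have "N SEL = M SEL" "N 0 = M 0" by (simp_all add: d_def c_def put_apply)
    then show ?case using 3(2) assms(1) by (simp add: d_def sum put_apply)
  qed (auto simp: d_def c_def)
  then have N: "N OBJ 0 = obj (M 0) T"
    using sum_ind[OF assms(2)] by (simp add: put_apply obj_def)
  have frame: "N b = M b" if "b \<notin> {OBJ, VJ, VK}" for b
    using that by (simp add: N_def d_def c_def sem_frame put_apply)
  define C where "C = For VJ 0 (Assign OUT (var VJ) (Get SEL (var VJ)))"
  have submit: "sem submit M = sem (IfElse (Sub (var OBJ) (var TOP)) (assign TOP (var OBJ) ;; C) Nop) N"
    by (simp add: submit_def N_def d_def c_def C_def)
  show ?thesis
  proof (cases "obj (M 0) T' < obj (M 0) T")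
    case True
    let ?N = "put N TOP 0 (N OBJ 0)"
    have "sem C ?N OUT = (\<lambda>j. if j < ?N 0 0 then ind T j else ?N OUT j)"
      unfolding C_def by (rule array_loop) (use assms(1) frame in \<open>auto simp: put_apply\<close>)
    also have "\<dots> = ind T"
      using assms(2,4) frame by (intro ext) (auto simp: put_apply best_def ind_def)
    finally have "sem C ?N OUT = ind T" .
    moreover have "sem C ?N 0 = M 0" "sem C ?N TOP 0 = obj (M 0) T"
      using N frame by (simp_all add: C_def sem_frame put_apply)
    moreover have "sem submit M = sem C ?N"
      using True N frame assms(4) by (simp add: submit best_def)
    ultimately have "best (sem submit M) T"
      using assms(2,3) by (simp add: best_def)
    then show ?thesis using True that by simp
  next
    case False
    then have "sem submit M = N" using N frame assms(4) by (simp add: submit best_def)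
    then have "best (sem submit M) T'" using assms(4) frame by (simp add: best_def)
    then show ?thesis using False that by simp
  qed
qed

lemma sem_clear: "M SEL = ind T \<Longrightarrow> T \<subseteq> {..<M 0 0} \<Longrightarrow> sem clear M SEL = ind {}"
  unfolding clear_def
  by (subst array_loop[where F = "\<lambda>_. 0"]) (auto simp: put_apply ind_def fun_eq_iff)

lemma fits_empty: "fits A h {}"
  by (simp add: fits_def)

lemma sem_mark_light: "j < M 0 0 \<Longrightarrow> sem mark_light M LIGHT j = of_bool (light (M 0) j)"
proof -
  assume j: "j < M 0 0"
  define c where "c = IfElse (Sub (Mul (Mul (Const 4) (var 0))
           (Mul (usage_expr (var VI) (var VJ)) (usage_expr (var VI) (var VJ))))
         (Mul (budget_expr (var VI)) (budget_expr (var VI))))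
       (Assign LIGHT (var VJ) (Const 0)) Nop"
  \<comment> \<open>The flag rule is applied at an arbitrary cell \<open>l\<close>, with a condition
    that is vacuous for \<open>l\<close> other than the current item. This also shows that the inner
    loop leaves other cells alone, as \<open>array_loop\<close> demands.\<close>
  have inner: "sem (For VI 1 c) N LIGHT l = (if \<forall>i<N 0 1. l \<noteq> N VJ 0 \<or>
      4 * N 0 0 * (usage (N 0) i l * usage (N 0) i l) \<le> budget (N 0) i * budget (N 0) i
      then N LIGHT l else 0)" for N l
    by (rule flag_loop) (auto simp: c_def put_apply)
  have "sem (For VJ 0 (Assign LIGHT (var VJ) (Const 1) ;; For VI 1 c)) M LIGHT =
      (\<lambda>j. if j < M 0 0 then of_bool (light (M 0) j) else M LIGHT j)"
    by (rule array_loop) (auto simp: inner light_def put_apply, auto simp: c_def)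
  then show ?thesis using j by (simp add: mark_light_def c_def)
qed

lemma sem_degrees:
  assumes "j < M 0 0" "L = LIGHT \<or> L = SEL"
  shows "sem (degrees L) M VAL j = (\<Sum>k<M 0 0. if M L k = 0 then 0 else cut (M 0) j k)"
proof -
  define c where "c = IfElse (Get L (var VK))
       (Assign VAL (var VJ) (Add (Get VAL (var VJ)) (cut_expr (var VJ) (var VK)))) Nop"
  have inner: "sem (For VK 0 c) N VAL l = N VAL l + (\<Sum>k<N 0 0. if l \<noteq> N VJ 0 \<or> N L k = 0 then 0 else
      cut (N 0) l k)" for N l
    by (rule sum_loop) (use assms(2) in \<open>auto simp: c_def put_apply\<close>)
  have "sem (For VJ 0 (Assign VAL (var VJ) (Const 0) ;; For VK 0 c)) M VAL =
      (\<lambda>j. if j < M 0 0 then (\<Sum>k<M 0 0. if M L k = 0 then 0 else cut (M 0) j k) else M VAL j)"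
  proof (rule array_loop, goal_cases)
    case (3 i N)
    then have "N 0 = M 0" "N L = M L" using assms(2) by (auto simp: c_def)
    then show ?case using 3(2) assms(2) by (auto simp: inner put_apply cong: if_cong)
  qed (use assms(2) in \<open>auto simp: inner put_apply\<close>, auto simp: c_def)
  then show ?thesis using assms(1) by (simp add: degrees_def c_def)
qed

lemma sem_drop_heavy:
  "j < M 0 0 \<Longrightarrow> sem drop_heavy M VAL j = (if M LIGHT j = 0 then 0 else M VAL j)"
  unfolding drop_heavy_def
  by (subst array_loop[where F = "\<lambda>j. if M LIGHT j = 0 then 0 else M VAL j"]) (auto simp: put_apply)

text \<open>The array of values agrees with the intended weights only below \<open>n\<close>; beyond
  it, the contents are unspecified.\<close>

lemma greedy_cong:
  assumes "greedy A h w S T" "\<And>j. j < A 0 \<Longrightarrow> w j = w' j"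
  shows "greedy A h w' S T"
proof -
  have "T \<subseteq> {..<A 0}" using assms(1) by (simp add: greedy_def)
  then have "{k\<in>T. k \<in> S \<or> w' j \<le> w' k} = {k\<in>T. k \<in> S \<or> w j \<le> w k}" if "j < A 0" for j
    using assms(2) that by auto
  then show ?thesis using assms by (simp add: greedy_def)
qed

text \<open>The guarantee is conditional because the run starts from the empty set if item
  \<open>VV\<close> alone does not fit. Such an item lies in no feasible solution, so nothing is
  lost.\<close>

lemma sem_star:
  assumes "M SEL = ind S0" "S0 \<subseteq> {..<M 0 0}" "best M T'" "M VV 0 < M 0 0"
  obtains T S1 where "best (sem star M) T" "obj (M 0) T' \<le> obj (M 0) T"
    "sem star M SEL = ind S1" "S1 \<subseteq> {..<M 0 0}"
    "fits (M 0) 1 {M VV 0} \<Longrightarrow> \<exists>S. greedy (M 0) 1 (\<lambda>j. cut (M 0) (M VV 0) j + gain (M 0) j) {M VV 0} S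
      \<and> obj (M 0) S \<le> obj (M 0) T"
proof -
  define A v where "A = M 0" "v = M VV 0"
  define C where "C = For VJ 0 (Assign VAL (var VJ) (Add (cut_expr (var VV) (var VJ)) (gain_expr (var VJ))))"
  define M1 where "M1 = sem C M"
  define M2 where "M2 = put (put (sem clear M1) SCALE 0 1) PICK 0 v"
  define M3 where "M3 = sem attempt M2"
  define M4 where "M4 = sem fill M3"
  have "sem C M VAL = (\<lambda>j. if j < M 0 0 then cut A v j + gain A j else M VAL j)"
    unfolding C_def by (rule array_loop) (auto simp: put_apply A_v_def cut_expr_def cut_def)
  then have val1: "M1 VAL j = cut A v j + gain A j" if "j < A 0" for j
    using that by (simp add: M1_def A_v_def)
  have fr1: "M1 b = M b" if "b \<notin> {VJ, VAL}" for b
    using that by (simp add: M1_def C_def sem_frame)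
  have fr2: "M2 b = M1 b" if "b \<notin> {VJ, SEL, SCALE, PICK}" for b
    using that by (simp add: M2_def sem_frame put_apply)
  have sel2: "M2 SEL = ind {}"
    using sem_clear[of M1 S0] assms fr1 by (simp add: M2_def put_apply)
  have M2: "M2 0 = A" "M2 SCALE 0 = 1" "M2 PICK 0 = v"
    using fr1 fr2 by (simp_all add: M2_def put_apply A_v_def sem_frame)
  define S where "S = (if fits A 1 {v} then {v} else {})"
  have S: "M3 SEL = ind S" "S \<subseteq> {..<A 0}" "fits A 1 S"
    using sem_attempt[of M2 "{}"] sel2 M2 assms(4) by (auto simp: M3_def S_def fits_empty A_v_def)
  have fr3: "M3 b = M2 b" if "b \<notin> {SEL, OK, VI, ACC, VK}" for b
    using that by (simp add: M3_def sem_frame)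
  have M3: "M3 0 = A" "M3 SCALE 0 = 1" using fr3 M2 by simp_all
  obtain T where T: "M4 SEL = ind T" "greedy A 1 (M3 VAL) S T"
    using sem_fill[of M3 S] S M3 unfolding M4_def by auto
  have fr4: "M4 b = M3 b" if "b \<notin> {VR, PICK, VJ, VAL, SEL, OK, VI, ACC, VK}" for b
    using that by (simp add: M4_def sem_frame)
  have M4: "M4 0 = A" "best M4 T'"
    using assms(3) fr1 fr2 fr3 fr4 M3 by (auto simp: best_def A_v_def)
  have T': "T \<subseteq> {..<A 0}" "fits A 1 T" using T(2) by (auto simp: greedy_def)
  obtain U where U: "best (sem submit M4) U" "obj A T \<le> obj A U" "obj A T' \<le> obj A U"
    using sem_submit[of M4 T T'] T(1) T' M4 by auto
  have star: "sem star M = sem submit M4"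
    by (simp add: star_def M4_def M3_def M2_def M1_def C_def sem_frame A_v_def put_apply)
  have g: "greedy A 1 (\<lambda>j. cut A v j + gain A j) S T"
    using T(2) by (rule greedy_cong) (simp add: val1 fr2 fr3)
  show ?thesis
  proof (rule that)
    show "sem star M SEL = ind T" using T(1) by (simp add: star sem_frame)
  qed (use U T' g in \<open>auto simp: star A_v_def[symmetric] S_def\<close>)
qed

lemma sem_dense:
  assumes "M SEL = ind S0" "S0 \<subseteq> {..<M 0 0}" "best M T'"
  obtains T S1 S2 where "best (sem dense M) T" "obj (M 0) T' \<le> obj (M 0) T"
    "greedy (M 0) 2 (\<lambda>j. \<Sum>k | k < M 0 0 \<and> light (M 0) k. cut (M 0) j k) {} S1"
    "greedy (M 0) 1 (\<lambda>j. if light (M 0) j then \<Sum>k\<in>S1. cut (M 0) j k else 0) S1 S2"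
    "obj (M 0) S2 \<le> obj (M 0) T"
proof -
  define A where "A = M 0"
  define M1 where "M1 = sem mark_light M"
  define M2 where "M2 = sem (degrees LIGHT) M1"
  define M3 where "M3 = put (sem clear M2) SCALE 0 2"
  define M4 where "M4 = sem fill M3"
  define M5 where "M5 = sem (degrees SEL) M4"
  define M6 where "M6 = put (sem drop_heavy M5) SCALE 0 1"
  define M7 where "M7 = sem fill M6"
  have fr1: "M1 b = M b" if "b \<notin> {VJ, LIGHT, VI}" for b
    using that by (simp add: M1_def sem_frame)
  have fr2: "M2 b = M1 b" if "b \<notin> {VJ, VAL, VK}" for b
    using that by (simp add: M2_def sem_frame)
  have fr3: "M3 b = M2 b" if "b \<notin> {VJ, SEL, SCALE}" for b
    using that by (simp add: M3_def sem_frame put_apply)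
  have fr4: "M4 b = M3 b" if "b \<notin> {VR, PICK, VJ, VAL, SEL, OK, VI, ACC, VK}" for b
    using that by (simp add: M4_def sem_frame)
  have fr5: "M5 b = M4 b" if "b \<notin> {VJ, VAL, VK}" for b
    using that by (simp add: M5_def sem_frame)
  have fr6: "M6 b = M5 b" if "b \<notin> {VJ, VAL, SCALE}" for b
    using that by (simp add: M6_def sem_frame put_apply)
  have fr7: "M7 b = M6 b" if "b \<notin> {VR, PICK, VJ, VAL, SEL, OK, VI, ACC, VK}" for b
    using that by (simp add: M7_def sem_frame)
  have A: "M 0 = A" "M1 0 = A" "M2 0 = A" "M3 0 = A" "M4 0 = A" "M5 0 = A" "M6 0 = A" "M7 0 = A"
    by (simp_all add: A_def fr1 fr2 fr3 fr4 fr5 fr6 fr7)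
  have l1: "M1 LIGHT j = of_bool (light A j)" if "j < A 0" for j
    using sem_mark_light[of j M] that by (simp add: M1_def A_def)
  have v2: "M2 VAL j = (\<Sum>k | k < A 0 \<and> light A k. cut A j k)" if "j < A 0" for j
  proof -
    have "M2 VAL j = (\<Sum>k<A 0. if M1 LIGHT k = 0 then 0 else cut A j k)"
      using sem_degrees[of j M1 LIGHT] that A by (simp add: M2_def cong: if_cong)
    also have "\<dots> = (\<Sum>k | k < A 0 \<and> light A k. cut A j k)"
      by (rule sum.mono_neutral_cong_right) (auto simp: l1)
    finally show ?thesis .
  qed
  have s3: "M3 SEL = ind {}"
    using sem_clear[of M2 S0] assms fr1 fr2 by (simp add: M3_def put_apply)
  obtain S1 where S1: "M4 SEL = ind S1" "greedy A 2 (M3 VAL) {} S1"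
    using sem_fill[of M3 "{}"] s3 A fits_empty
    unfolding M4_def by (auto simp: M3_def put_apply)
  have S1': "S1 \<subseteq> {..<A 0}" "fits A 1 S1"
    using S1(2) by (auto simp: greedy_def fits_def)
  have v5: "M5 VAL j = (\<Sum>k\<in>S1. cut A j k)" if "j < A 0" for j
    using sem_degrees[of j M4 SEL] that A S1(1) sum_ind[OF S1'(1)] by (simp add: M5_def cong: if_cong)
  have v6: "M6 VAL j = (if light A j then \<Sum>k\<in>S1. cut A j k else 0)" if "j < A 0" for j
    using sem_drop_heavy[of j M5] that A v5 by (simp add: M6_def put_apply l1 fr5 fr4 fr3 fr2)
  obtain S2 where S2: "M7 SEL = ind S2" "greedy A 1 (M6 VAL) S1 S2"
    using sem_fill[of M6 S1] S1 S1' A fr5 fr6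
    unfolding M7_def by (auto simp: M6_def put_apply)
  have S2': "S2 \<subseteq> {..<A 0}" "fits A 1 S2" using S2(2) by (auto simp: greedy_def)
  have "best M7 T'"
    using assms(3) by (auto simp: best_def fr1 fr2 fr3 fr4 fr5 fr6 fr7)
  then obtain U where U: "best (sem submit M7) U" "obj A S2 \<le> obj A U" "obj A T' \<le> obj A U"
    using sem_submit[of M7 S2 T'] S2(1) S2' A by auto
  have "sem dense M = sem submit M7"
    by (simp add: dense_def M7_def M6_def M5_def M4_def M3_def M2_def M1_def)
  moreover have "greedy A 2 (\<lambda>j. \<Sum>k | k < A 0 \<and> light A k. cut A j k) {} S1"
    using S1(2) by (rule greedy_cong) (simp add: v2 fr3)
  moreover have "greedy A 1 (\<lambda>j. if light A j then \<Sum>k\<in>S1. cut A j k else 0) S1 S2"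
    using S2(2) by (rule greedy_cong) (simp add: v6)
  ultimately show ?thesis
    using U by (intro that[folded A_def, of U S1 S2]) simp_all
qed

lemma sem_piqp_prog:
  assumes "M = init_mem xs"
  obtains T S1 S2 where "sem piqp_prog M OUT = ind T" "T \<subseteq> {..<M 0 0}" "fits (M 0) 1 T"
    "\<And>v. v < M 0 0 \<Longrightarrow> fits (M 0) 1 {v} \<Longrightarrow>
      \<exists>S. greedy (M 0) 1 (\<lambda>j. cut (M 0) v j + gain (M 0) j) {v} S \<and> obj (M 0) S \<le> obj (M 0) T"
    "greedy (M 0) 2 (\<lambda>j. \<Sum>k | k < M 0 0 \<and> light (M 0) k. cut (M 0) j k) {} S1"
    "greedy (M 0) 1 (\<lambda>j. if light (M 0) j then \<Sum>k\<in>S1. cut (M 0) j k else 0) S1 S2"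
    "obj (M 0) S2 \<le> obj (M 0) T"
proof -
  define A where "A = M 0"
  define P where "P = (\<lambda>i N. \<exists>T S1. best N T \<and> N 0 = A \<and> N SEL = ind S1 \<and> S1 \<subseteq> {..<A 0} \<and>
    (\<forall>v<i. fits A 1 {v} \<longrightarrow>
      (\<exists>S. greedy A 1 (\<lambda>j. cut A v j + gain A j) {v} S \<and> obj A S \<le> obj A T)))"
  have "P (M 0 0) (sem (For VV 0 star) M)"
  proof (rule sem_For_induct)
    show "wf (For VV 0 star)" by simp
    have "best (put M VV 0 0) {}"
      using assms by (auto simp: best_def put_apply fits_empty obj_def init_mem_def ind_def)
    moreover have "M SEL = ind {}" using assms by (auto simp: init_mem_def ind_def)
    ultimately show "P 0 (put M VV 0 0)"
      unfolding P_def by (auto simp: put_apply A_def)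
  next
    fix i N
    assume i: "i < M 0 0" and P: "P i N" and "N VV 0 = i"
      and frame: "\<And>a. a \<notin> writes (For VV 0 star) \<Longrightarrow> N a = M a"
    from P obtain T S0 where N: "best N T" "N 0 = A" "N SEL = ind S0" "S0 \<subseteq> {..<A 0}"
      and T: "\<And>v. v < i \<Longrightarrow> fits A 1 {v} \<Longrightarrow>
        \<exists>S. greedy A 1 (\<lambda>j. cut A v j + gain A j) {v} S \<and> obj A S \<le> obj A T"
      unfolding P_def by auto
    obtain T' S1 where T': "best (sem star N) T'" "obj A T \<le> obj A T'"
      "sem star N SEL = ind S1" "S1 \<subseteq> {..<A 0}"
      "fits A 1 {i} \<Longrightarrow> \<exists>S. greedy A 1 (\<lambda>j. cut A i j + gain A j) {i} S
      \<and> obj A S \<le> obj A T'"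
      using sem_star[of N S0 T] N i \<open>N VV 0 = i\<close> unfolding A_def by auto
    have "best (put (sem star N) VV 0 (Suc i)) T'" using T'(1) by (simp add: best_def put_apply)
    moreover have "sem star N 0 = A" using N by (simp add: sem_input)
    moreover have "\<exists>S. greedy A 1 (\<lambda>j. cut A v j + gain A j) {v} S \<and> obj A S \<le> obj A T'"
      if "v < Suc i" "fits A 1 {v}" for v
      using T[of v] T'(2,5) that order.trans by (cases "v = i") fastforce+
    ultimately show "P (Suc i) (put (sem star N) VV 0 (Suc i))"
      unfolding P_def using T'(3,4) by (intro exI[of _ T'] exI[of _ S1]) (auto simp: put_apply)
  qed
  then obtain T0 S0 where T0: "best (sem (For VV 0 star) M) T0" "sem (For VV 0 star) M 0 = A"
    "sem (For VV 0 star) M SEL = ind S0" "S0 \<subseteq> {..<A 0}"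
    "\<And>v. v < A 0 \<Longrightarrow> fits A 1 {v} \<Longrightarrow>
        \<exists>S. greedy A 1 (\<lambda>j. cut A v j + gain A j) {v} S \<and> obj A S \<le> obj A T0"
    unfolding P_def A_def by auto
  obtain T S1 S2 where T: "best (sem piqp_prog M) T" "obj A T0 \<le> obj A T"
    "greedy A 2 (\<lambda>j. \<Sum>k | k < A 0 \<and> light A k. cut A j k) {} S1"
    "greedy A 1 (\<lambda>j. if light A j then \<Sum>k\<in>S1. cut A j k else 0) S1 S2"
    "obj A S2 \<le> obj A T"
    using sem_dense[of "sem (For VV 0 star) M" S0 T0] T0 unfolding piqp_prog_def by auto
  have "sem piqp_prog M 0 = A" using wf_piqp_prog by (simp add: sem_input A_def)
  moreover have "\<exists>S. greedy A 1 (\<lambda>j. cut A v j + gain A j) {v} S \<and> obj A S \<le> obj A T"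
    if "v < A 0" "fits A 1 {v}" for v
    using T0(5)[OF that] T(2) order.trans by blast
  ultimately show ?thesis
    using T that[of T S1 S2] unfolding A_def best_def by auto
qed


section \<open>The approximation factor\<close>

text \<open>A natural number is the count of thresholds from 1 up to it, so a sum of weights is the
  sum of the sizes of the level sets. Weighted comparisons thus reduce to counting at each
  level.\<close>

lemma layer_cake:
  fixes w :: "'a \<Rightarrow> nat" and C :: real
  assumes "finite X" "finite T"
    and "\<And>\<theta>. 1 \<le> \<theta> \<Longrightarrow> real (card {j\<in>X. \<theta> \<le> w j}) \<le> C * real (card {j\<in>T. \<theta> \<le> w j})"
  shows "real (sum w X) \<le> C * real (sum w T)"
proof -
  define B where "B = sum w (X \<union> T)"
  have sum: "sum w Y = (\<Sum>\<theta>=1..B. card {j\<in>Y. \<theta> \<le> w j})" if "Y \<subseteq> X \<union> T" for Y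
  proof -
    have fin: "finite Y" using that assms(1,2) by (meson finite_UnI finite_subset)
    have "w j = (\<Sum>\<theta>=1..B. of_bool (\<theta> \<le> w j))" if "j \<in> Y" for j
    proof -
      have "w j \<le> B" unfolding B_def
        using \<open>j \<in> Y\<close> \<open>Y \<subseteq> X \<union> T\<close> assms(1,2) by (intro member_le_sum) auto
      then have "{1..B} \<inter> {\<theta>. \<theta> \<le> w j} = {1..w j}" by auto
      then show ?thesis by (simp add: sum.If_cases of_bool_def)
    qed
    then have "sum w Y = (\<Sum>j\<in>Y. \<Sum>\<theta>=1..B. of_bool (\<theta> \<le> w j))" by (rule sum.cong[OF refl])
    also have "\<dots> = (\<Sum>\<theta>=1..B. \<Sum>j\<in>Y. of_bool (\<theta> \<le> w j))" by (rule sum.swap)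
    also have "\<dots> = (\<Sum>\<theta>=1..B. card {j\<in>Y. \<theta> \<le> w j})"
      using fin by (simp add: of_bool_def sum.If_cases Int_def)
    finally show ?thesis .
  qed
  have "real (sum w X) = (\<Sum>\<theta>=1..B. real (card {j\<in>X. \<theta> \<le> w j}))"
    by (subst sum) auto
  also have "\<dots> \<le> (\<Sum>\<theta>=1..B. C * real (card {j\<in>T. \<theta> \<le> w j}))"
    by (intro sum_mono assms(3)) auto
  also have "\<dots> = C * real (sum w T)"
    by (simp only: sum[OF Un_upper2] of_nat_sum sum_distrib_left)
  finally show ?thesis .
qed

text \<open>Keep the linear part and only row \<open>v\<close> of the quadratic part.\<close>

lemma obj_ge_gain: "finite T \<Longrightarrow> v \<in> T \<Longrightarrow> (\<Sum>j\<in>T. cut A v j + gain A j) \<le> obj A T"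
  using member_le_sum[of v T "\<lambda>j. \<Sum>k\<in>T. cut A j k"]
  by (simp add: obj_def sum.distrib)

lemma obj_ge_cut:
  assumes "finite T" "S \<subseteq> T"
  shows "(\<Sum>j\<in>T. \<Sum>k\<in>S. cut A j k) \<le> obj A T"
proof -
  have "(\<Sum>j\<in>T. \<Sum>k\<in>S. cut A j k) \<le> (\<Sum>j\<in>T. \<Sum>k\<in>T. cut A j k)"
    using assms by (intro sum_mono sum_mono2) auto
  then show ?thesis by (simp add: obj_def sum.distrib)
qed

lemma obj_mono: "S \<subseteq> T \<Longrightarrow> finite T \<Longrightarrow> obj A S \<le> obj A T"
  unfolding obj_def
  by (rule order.trans[OF sum_mono sum_mono2]) (auto intro: sum_mono2)

text \<open>The entry \<open>a\<^sub>i\<^sub>k\<close> of the constraint matrix is \<open>usage A i k / d i\<close>, hence a natural number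
  at most \<open>a\<close>.\<close>

locale packing =
  fixes A :: "nat \<Rightarrow> nat" and a :: nat and d :: "nat \<Rightarrow> nat"
  assumes vars_pos: "0 < A 0"
    and cut_sym: "\<lbrakk>j < A 0; k < A 0\<rbrakk> \<Longrightarrow> cut A j k = cut A k j"
    and gain_pos: "j < A 0 \<Longrightarrow> 0 < gain A j"
    and budget_pos: "i < A 1 \<Longrightarrow> 0 < budget A i"
    and d_pos: "i < A 1 \<Longrightarrow> 0 < d i"
    and usage_le: "\<lbrakk>i < A 1; k < A 0\<rbrakk> \<Longrightarrow> usage A i k \<le> a * d i"
    and usage_ge: "\<lbrakk>i < A 1; k < A 0; 0 < usage A i k\<rbrakk> \<Longrightarrow> d i \<le> usage A i k"
begin

text \<open>Every item of \<open>X\<close> above the level \<open>\<theta>\<close> which the greedy algorithm rejects is rejected by a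
  constraint \<open>i\<close> which the items it has chosen above that level nearly exhaust. Each of these
  contributes at most \<open>a\<close> times as much to constraint \<open>i\<close> as a rejected item does.\<close>

lemma greedy_level:
  assumes greedy: "greedy A h w S T" and X: "X \<subseteq> {..<A 0}" "fits A 1 X"
    and init: "\<And>j. j \<in> X \<Longrightarrow> fits A h (insert j S)" and S: "card S \<le> s" and \<theta>: "1 \<le> \<theta>"
  shows "card {j\<in>X - S. \<theta> \<le> w j} \<le> (1 + A 1 * (h * a * (s + 2))) * card {j\<in>T - S. \<theta> \<le> w j}"
proof -
  define X' where "X' = {j\<in>X - S. \<theta> \<le> w j}"
  define T' where "T' = {j\<in>T - S. \<theta> \<le> w j}"
  define before where "before = (\<lambda>j. {k\<in>T. k \<in> S \<or> w j \<le> w k})"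
  have T: "T \<subseteq> {..<A 0}" "S \<subseteq> T" "fits A h T"
    and rej: "\<And>j. \<lbrakk>j < A 0; 0 < w j; j \<notin> T\<rbrakk> \<Longrightarrow> \<not> fits A h (insert j (before j))"
    using greedy by (auto simp: greedy_def before_def)
  have fin: "finite T" "finite X" "finite S" "finite X'" "finite T'"
    using T X(1) finite_subset[of _ "{..<A 0}"] by (auto simp: X'_def T'_def)
  have before: "before j \<subseteq> S \<union> T'" "j \<notin> T" if "j \<in> X' - T" for j
    using that by (auto simp: before_def X'_def T'_def)
  \<comment> \<open>Rejected items are charged to a constraint that they would violate; it then
    suffices to bound the charges to each constraint.\<close>
  define rejected where
    "rejected = (\<lambda>i. {j\<in>X' - T. budget A i < h * (\<Sum>k\<in>insert j (before j). usage A i k)})"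
  have all: "X' \<subseteq> T' \<union> (\<Union>i<A 1. rejected i)"
  proof
    fix j assume j: "j \<in> X'"
    show "j \<in> T' \<union> (\<Union>i<A 1. rejected i)"
    proof (cases "j \<in> T")
      case True
      then show ?thesis using j by (auto simp: X'_def T'_def)
    next
      case False
      then have "\<not> fits A h (insert j (before j))"
        using j X \<theta> by (intro rej) (auto simp: X'_def)
      then show ?thesis using j False by (auto simp: fits_def rejected_def not_le)
    qed
  qed
  show ?thesis
  proof (cases "X' \<subseteq> T")
    case True
    then have "card X' \<le> 1 * card T'" using fin by (auto intro!: card_mono simp: X'_def T'_def)
    also have "\<dots> \<le> (1 + A 1 * (h * a * (s + 2))) * card T'" by (intro mult_right_mono) auto
    finally show ?thesis by (simp add: X'_def T'_def)
  next
    case False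
    then obtain j where j: "j \<in> X' - T" by auto
    \<comment> \<open>Without a chosen item at this level, \<open>j\<close> would have been tested
      against items of \<open>S\<close> only, and it fits there by \<open>init\<close>.\<close>
    have "T' \<noteq> {}"
    proof
      assume "T' = {}"
      then have "insert j (before j) \<subseteq> insert j S" using before[OF j] by auto
      then have "fits A h (insert j (before j))"
        using init[of j] j fin fits_mono by (auto simp: X'_def)
      then show False using rej[of j] j X \<theta> by (auto simp: X'_def)
    qed
    then have t: "1 \<le> card T'" using fin by (metis One_nat_def Suc_leI card_gt_0_iff)
    have card: "card (rejected i) \<le> h * a * (s + 2) * card T'" if i: "i < A 1" for i
    proof (cases "rejected i = {}")
      case False
      then obtain l where l: "l \<in> rejected i" by auto
      then have lX: "l \<in> X' - T" by (simp add: rejected_def)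
      have fX: "finite (rejected i)" using fin by (simp add: rejected_def)
      have sub: "insert l (before l) \<subseteq> insert l (S \<union> T')" using before[OF lX] by auto
      have "insert l (S \<union> T') \<subseteq> {..<A 0}"
        using lX X T by (auto simp: X'_def T'_def)
      then have "(\<Sum>k\<in>insert l (before l). usage A i k) \<le> (\<Sum>k\<in>insert l (before l). a * d i)"
        using i sub by (intro sum_mono usage_le) auto
      also have "\<dots> \<le> (\<Sum>k\<in>insert l (S \<union> T'). a * d i)"
        using sub fin by (intro sum_mono2) auto
      also have "\<dots> = card (insert l (S \<union> T')) * (a * d i)" by simp
      also have "\<dots> \<le> (1 + (s + card T')) * (a * d i)"
        using S card_Un_le[of S T'] card_insert_le_m1[of "1 + (s + card T')" "S \<union> T'" l]
        by (intro mult_right_mono) auto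
      \<comment> \<open>As \<open>T'\<close> is nonempty, the \<open>s + 1\<close> items outside it
        can be absorbed into a multiple of its size.\<close>
      also have "\<dots> \<le> (s + 2) * card T' * (a * d i)"
        using t mult_le_mono2[OF t, of s] unfolding mult_1_right distrib_right[of s 2]
        by (intro mult_right_mono) linarith+
      finally have le: "h * (\<Sum>k\<in>insert l (before l). usage A i k) \<le> h * ((s + 2) * card T' * (a * d i))"
        by (rule mult_le_mono2)
      have "budget A i < h * (\<Sum>k\<in>insert l (before l). usage A i k)"
        using l by (simp add: rejected_def)
      also note le
      also have "h * ((s + 2) * card T' * (a * d i)) = h * a * (s + 2) * card T' * d i"
        by (simp only: mult_ac)
      finally have u: "budget A i < h * a * (s + 2) * card T' * d i" .
      \<comment> \<open>An item that uses nothing of budget \<open>i\<close> cannot break constraint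
        \<open>i\<close>, since the items before it fit. So its matrix entry is positive, hence at
        least 1.\<close>
      have "d i \<le> usage A i k" if k: "k \<in> rejected i" for k
      proof (rule usage_ge[OF i])
        have kX: "k \<in> X' - T" using k by (simp add: rejected_def)
        then show "k < A 0" using X by (auto simp: X'_def)
        have "finite (before k)" "before k \<subseteq> T" "k \<notin> before k"
          using kX fin by (auto simp: before_def)
        moreover have "h * (\<Sum>k\<in>before k. usage A i k) \<le> budget A i"
          using fits_mono[OF T(3) \<open>before k \<subseteq> T\<close>] fin i by (simp add: fits_def)
        ultimately show "0 < usage A i k" using k by (cases "usage A i k") (auto simp: rejected_def)
      qed
      \<comment> \<open>\<open>X\<close> must pay for all these items within a budget that
        \<open>T'\<close> nearly exhausts. The scale \<open>d i\<close> occurs on both sides and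
        cancels.\<close>
      then have "card (rejected i) * d i \<le> (\<Sum>k\<in>rejected i. usage A i k)"
        using sum_bounded_below[of "rejected i" "d i" "usage A i"] by simp
      also have "\<dots> \<le> (\<Sum>k\<in>X. usage A i k)"
        using fin by (intro sum_mono2) (auto simp: rejected_def X'_def)
      also have "\<dots> \<le> budget A i" using X(2) i by (simp add: fits_def)
      also note u
      finally show ?thesis by simp
    qed simp
    have "card X' \<le> card (T' \<union> (\<Union>i<A 1. rejected i))"
      using all fin by (intro card_mono) (auto simp: rejected_def)
    also have "\<dots> \<le> card T' + (\<Sum>i<A 1. card (rejected i))"
      using card_Un_le[of T' "\<Union>i<A 1. rejected i"] card_UN_le[of "{..<A 1}" rejected] by simp
    also have "\<dots> \<le> card T' + (\<Sum>i<A 1. h * a * (s + 2) * card T')"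
      using card by (intro add_left_mono sum_mono) auto
    also have "\<dots> = (1 + A 1 * (h * a * (s + 2))) * card T'" by (simp add: algebra_simps)
    finally show ?thesis by (simp add: X'_def T'_def)
  qed
qed

lemma greedy_sum:
  assumes greedy: "greedy A h w S T" and X: "X \<subseteq> {..<A 0}" "fits A 1 X"
    and init: "\<And>j. j \<in> X \<Longrightarrow> fits A h (insert j S)" and S: "card S \<le> s"
  shows "sum w (X - S) \<le> (1 + A 1 * (h * a * (s + 2))) * sum w (T - S)"
proof -
  have "T \<subseteq> {..<A 0}" using greedy by (simp add: greedy_def)
  then have fin: "finite (X - S)" "finite (T - S)" using X(1) finite_subset[of _ "{..<A 0}"] by auto
  have "real (sum w (X - S)) \<le> real (1 + A 1 * (h * a * (s + 2))) * real (sum w (T - S))"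
    using greedy_level[OF assms] fin
    by (intro layer_cake) (auto simp flip: of_nat_mult simp del: of_nat_add of_nat_Suc)
  then show ?thesis by (simp only: of_nat_le_iff flip: of_nat_mult)
qed

lemma fits_subset: "fits A h X \<Longrightarrow> Y \<subseteq> X \<Longrightarrow> X \<subseteq> {..<A 0} \<Longrightarrow> fits A h Y"
  using fits_mono finite_subset[OF _ finite_lessThan] by blast

lemma greedy_star:
  assumes greedy: "greedy A 1 (\<lambda>j. cut A v j + gain A j) {v} T"
    and X: "X \<subseteq> {..<A 0}" "fits A 1 X" "v \<in> X"
  shows "(\<Sum>j\<in>X. cut A v j + gain A j) \<le> (1 + 3 * A 1 * a) * obj A T"
proof -
  let ?w = "\<lambda>j. cut A v j + gain A j"
  have T: "finite T" "v \<in> T" using greedy finite_subset[of T "{..<A 0}"] by (auto simp: greedy_def)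
  \<comment> \<open>Here \<open>h = 1\<close> and \<open>s = 1\<close>, which gives the constant 3.
    The premise \<open>init\<close> holds because each pair of \<open>v\<close> and an item of
    \<open>X\<close> lies in \<open>X\<close>.\<close>
  have "sum ?w (X - {v}) \<le> (1 + A 1 * (1 * a * (1 + 2))) * sum ?w (T - {v})"
    using fits_subset[OF X(2)] X by (intro greedy_sum[OF greedy]) auto
  then have "?w v + sum ?w (X - {v}) \<le> (1 + 3 * A 1 * a) * (?w v + sum ?w (T - {v}))"
    by (simp add: algebra_simps)
  moreover have "?w v + sum ?w (X - {v}) = sum ?w X" "?w v + sum ?w (T - {v}) = sum ?w T"
    using X T finite_subset[of X "{..<A 0}"] by (auto simp: sum.remove)
  ultimately have "sum ?w X \<le> (1 + 3 * A 1 * a) * sum ?w T" by simp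
  also have "\<dots> \<le> (1 + 3 * A 1 * a) * obj A T"
    using obj_ge_gain[OF T] by (rule mult_le_mono2)
  finally show ?thesis .
qed

lemma lightD:
  assumes "light A j" "i < A 1"
  shows "2 * sqrt (A 0) * real (usage A i j) \<le> real (budget A i)"
proof (rule power2_le_imp_le)
  have "real (4 * A 0 * (usage A i j * usage A i j)) \<le> real (budget A i * budget A i)"
    using assms unfolding light_def by (intro of_nat_mono) auto
  then show "(2 * sqrt (A 0) * real (usage A i j))\<^sup>2 \<le> (real (budget A i))\<^sup>2"
    by (simp add: power_mult_distrib) (simp add: power2_eq_square mult_ac)
qed simp

text \<open>Since \<open>sqrt n \<ge> 1\<close>, a light item uses at most half of each budget. This
  is the premise \<open>init\<close> for the first phase, which starts from the empty set.\<close>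

lemma light_fits: "light A j \<Longrightarrow> fits A 2 {j}"
proof -
  assume light: "light A j"
  have "2 * usage A i j \<le> budget A i" if "i < A 1" for i
  proof -
    have "1 \<le> sqrt (A 0)" using vars_pos by simp
    then have "2 * 1 * real (usage A i j) \<le> 2 * sqrt (A 0) * real (usage A i j)"
      by (intro mult_mono) auto
    then show ?thesis using lightD[OF light that] by linarith
  qed
  then show ?thesis by (simp add: fits_def)
qed

text \<open>A heavy item uses more than the fraction \<open>1 / (2 * sqrt n)\<close> of some budget,
  and at most \<open>2 * sqrt n\<close> such items of \<open>X\<close> can share the same
  budget.\<close>

lemma heavy_card:
  assumes X: "X \<subseteq> {..<A 0}" "fits A 1 X"
  shows "real (card {j\<in>X. \<not> light A j}) \<le> 2 * real (A 1) * sqrt (A 0)"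
proof -
  have fin: "finite X" using X(1) finite_subset by blast
  define H where "H = (\<lambda>i. {j\<in>X. real (budget A i) < 2 * sqrt (A 0) * real (usage A i j)})"
  have "{j\<in>X. \<not> light A j} \<subseteq> (\<Union>i<A 1. H i)"
  proof
    fix j assume "j \<in> {j\<in>X. \<not> light A j}"
    then obtain i where i: "j \<in> X" "i < A 1"
      "budget A i * budget A i < 4 * A 0 * (usage A i j * usage A i j)"
      by (auto simp: light_def not_le)
    have "real (budget A i * budget A i) < real (4 * A 0 * (usage A i j * usage A i j))"
      using i(3) by (simp only: of_nat_less_iff)
    then have "(real (budget A i))\<^sup>2 < (2 * sqrt (A 0) * real (usage A i j))\<^sup>2"
      by (simp add: power_mult_distrib) (simp add: power2_eq_square mult_ac)
    then have "real (budget A i) < 2 * sqrt (A 0) * real (usage A i j)"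
      by (rule power2_less_imp_less) simp
    then show "j \<in> (\<Union>i<A 1. H i)" using i by (auto simp: H_def)
  qed
  then have "card {j\<in>X. \<not> light A j} \<le> card (\<Union>i<A 1. H i)"
    using fin by (intro card_mono) (auto simp: H_def)
  also have "\<dots> \<le> (\<Sum>i<A 1. card (H i))"
    by (rule card_UN_le) simp
  finally have "real (card {j\<in>X. \<not> light A j}) \<le> (\<Sum>i<A 1. real (card (H i)))"
    by (simp flip: of_nat_sum)
  also have "\<dots> \<le> (\<Sum>i<A 1. 2 * sqrt (A 0))"
  proof (rule sum_mono)
    fix i assume "i \<in> {..<A 1}"
    then have i: "i < A 1" by simp
    have "real (card (H i)) * real (budget A i) \<le> (\<Sum>j\<in>H i. 2 * sqrt (A 0) * real (usage A i j))"
      by (intro sum_bounded_below) (auto simp: H_def)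
    also have "\<dots> = 2 * sqrt (A 0) * real (\<Sum>j\<in>H i. usage A i j)"
      by (simp add: sum_distrib_left)
    also have "(\<Sum>j\<in>H i. usage A i j) \<le> (\<Sum>j\<in>X. usage A i j)"
      using fin by (intro sum_mono2) (auto simp: H_def)
    also have "(\<Sum>j\<in>X. usage A i j) \<le> budget A i"
      using X(2) i by (simp add: fits_def)
    finally have "real (card (H i)) * real (budget A i) \<le> 2 * sqrt (A 0) * real (budget A i)"
      by (simp add: mult_left_mono)
    then show "real (card (H i)) \<le> 2 * sqrt (A 0)"
      using budget_pos[OF i] by simp
  qed
  finally show ?thesis by (simp add: mult_ac)
qed

text \<open>Half of each budget is left for the second phase, which suffices for about \<open>sqrt n\<close> of the
  at most \<open>n\<close> light items.\<close>

lemma greedy_light_level: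
  assumes S: "fits A 2 S" and \<theta>: "1 \<le> \<theta>"
    and greedy: "greedy A 1 w S T" and w: "\<And>j. 0 < w j \<Longrightarrow> light A j"
  shows "real (card {j\<in>{..<A 0}. \<theta> \<le> w j}) \<le> 2 * sqrt (A 0) * real (card {j\<in>T. \<theta> \<le> w j})"
proof -
  define X where "X = {j\<in>{..<A 0}. \<theta> \<le> w j}"
  define T' where "T' = {j\<in>T. \<theta> \<le> w j}"
  have T: "T \<subseteq> {..<A 0}" "S \<subseteq> T"
    and rej: "\<And>j. \<lbrakk>j < A 0; 0 < w j; j \<notin> T\<rbrakk> \<Longrightarrow> \<not> fits A 1 (insert j {k\<in>T. k \<in> S \<or> w j \<le> w k})"
    using greedy by (auto simp: greedy_def)
  have fin: "finite T" "finite S" "finite T'" "finite X"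
    using T finite_subset[of _ "{..<A 0}"] by (auto simp: T'_def X_def)
  have light: "light A j" if "j \<in> X \<union> T'" for j
    using that \<theta> by (intro w) (auto simp: X_def T'_def)
  have n1: "1 \<le> sqrt (A 0)" using vars_pos by simp
  show ?thesis
  proof (cases "X \<subseteq> T")
    case True
    then have "card X \<le> card T'" using fin by (intro card_mono) (auto simp: X_def T'_def)
    moreover have "1 \<le> 2 * sqrt (A 0)" using n1 by linarith
    ultimately have "1 * real (card X) \<le> 2 * sqrt (A 0) * real (card T')"
      by (intro mult_mono) auto
    then show ?thesis by (simp add: X_def T'_def)
  next
    case False
    then obtain j where j: "j \<in> X" "j \<notin> T" by auto
    then have "\<not> fits A 1 (insert j {k\<in>T. k \<in> S \<or> w j \<le> w k})"
      using \<theta> by (intro rej) (auto simp: X_def)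
    moreover have "{k\<in>T. k \<in> S \<or> w j \<le> w k} \<subseteq> S \<union> T'"
      using j by (auto simp: X_def T'_def)
    ultimately have "\<not> fits A 1 (insert j (S \<union> T'))"
      using fits_mono[of A 1 "insert j (S \<union> T')"] fin by (meson finite.insertI finite_UnI insert_mono)
    then obtain i where i: "i < A 1" "budget A i < (\<Sum>k\<in>insert j (S \<union> T'). usage A i k)"
      by (auto simp: fits_def not_le)
    have "(\<Sum>k\<in>insert j (S \<union> T'). usage A i k) = (\<Sum>k\<in>S \<union> insert j T'. usage A i k)"
      by simp
    also have "\<dots> \<le> (\<Sum>k\<in>S. usage A i k) + (\<Sum>k\<in>insert j T'. usage A i k)"
      using sum.union_inter[of S "insert j T'" "usage A i"] fin by simp
    \<comment> \<open>\<open>S\<close> takes at most half of the budget, so the violation forces the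
      other items to exceed the other half.\<close>
    finally have "budget A i < 2 * (\<Sum>k\<in>insert j T'. usage A i k)"
      using i S by (auto simp: fits_def)
    then have "real (budget A i) < real (2 * (\<Sum>k\<in>insert j T'. usage A i k))"
      by (simp only: of_nat_less_iff)
    then have "sqrt (A 0) * real (budget A i) < sqrt (A 0) * real (2 * (\<Sum>k\<in>insert j T'. usage A i k))"
      using n1 by (intro mult_strict_left_mono) auto
    also have "\<dots> = (\<Sum>k\<in>insert j T'. 2 * sqrt (A 0) * real (usage A i k))"
      by (simp add: sum_distrib_left mult_ac)
    also have "\<dots> \<le> real (card (insert j T')) * real (budget A i)"
      using light j i by (intro sum_bounded_above lightD) auto
    also have "card (insert j T') = card T' + 1"
      using j fin by (simp add: T'_def)
    finally have "sqrt (A 0) < real (card T' + 1)"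
      using budget_pos[OF i(1)] by simp
    \<comment> \<open>An empty \<open>T'\<close> would give \<open>sqrt n < 1\<close>; otherwise its
      size plus 1 is at most twice its size.\<close>
    then have t: "sqrt (A 0) \<le> 2 * real (card T')" using n1 by (cases "card T'") auto
    have "card X \<le> card {..<A 0}" by (intro card_mono) (auto simp: X_def)
    then have "real (card X) \<le> sqrt (A 0) * sqrt (A 0)" by simp
    also have "\<dots> \<le> sqrt (A 0) * (2 * real (card T'))"
      using t by (intro mult_left_mono) auto
    finally show ?thesis by (simp add: X_def T'_def mult_ac)
  qed
qed

text \<open>Two greedy comparisons joined by symmetry: \<open>S\<close> competes with
  \<open>X\<close> in degrees into the light items, and \<open>T\<close> competes with all light
  items in degrees into \<open>S\<close>. Since \<open>S\<close> is contained in \<open>T\<close>,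
  the last degrees count products inside \<open>T\<close>.\<close>

lemma greedy_dense:
  assumes S: "greedy A 2 (\<lambda>j. \<Sum>k | k < A 0 \<and> light A k. cut A j k) {} S"
    and T: "greedy A 1 (\<lambda>j. if light A j then \<Sum>k\<in>S. cut A j k else 0) S T"
    and X: "X \<subseteq> {j. j < A 0 \<and> light A j}" "fits A 1 X"
  shows "real (\<Sum>j\<in>X. \<Sum>k\<in>X. cut A j k) \<le> 2 * sqrt (A 0) * real (1 + 4 * A 1 * a) * real (obj A T)"
proof -
  define L where "L = {k. k < A 0 \<and> light A k}"
  define w where "w = (\<lambda>j. if light A j then \<Sum>k\<in>S. cut A j k else 0)"
  have ST: "S \<subseteq> {..<A 0}" "fits A 2 S" "T \<subseteq> {..<A 0}" "S \<subseteq> T"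
    using S T by (auto simp: greedy_def)
  have fin: "finite T" "finite L" "finite S"
    using ST finite_subset[of _ "{..<A 0}"] by (auto simp: L_def)
  have "(\<Sum>j\<in>X. \<Sum>k\<in>X. cut A j k) \<le> (\<Sum>j\<in>X. \<Sum>k\<in>L. cut A j k)"
    using X fin by (intro sum_mono sum_mono2) (auto simp: L_def)
  \<comment> \<open>\<open>h = 2\<close> because half of the budgets is reserved, and
    \<open>s = 0\<close> because the first phase starts from nothing.\<close>
  also have "\<dots> \<le> (1 + A 1 * (2 * a * (0 + 2))) * (\<Sum>j\<in>S. \<Sum>k\<in>L. cut A j k)"
    using greedy_sum[OF S, of X 0] X light_fits unfolding L_def by auto
  \<comment> \<open>Degrees of \<open>S\<close> into \<open>L\<close> become degrees of
    \<open>L\<close> into \<open>S\<close>, the weights of the second phase.\<close>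
  also have "(\<Sum>j\<in>S. \<Sum>k\<in>L. cut A j k) = (\<Sum>k\<in>L. \<Sum>j\<in>S. cut A k j)"
    using ST by (subst sum.swap) (auto simp: L_def intro!: sum.cong cut_sym)
  also have "(\<Sum>k\<in>L. \<Sum>j\<in>S. cut A k j) = sum w {..<A 0}"
    by (rule sum.mono_neutral_cong_left) (auto simp: L_def w_def)
  finally have "(\<Sum>j\<in>X. \<Sum>k\<in>X. cut A j k) \<le> (1 + 4 * A 1 * a) * sum w {..<A 0}"
    by (simp add: mult_ac)
  then have 1: "real (\<Sum>j\<in>X. \<Sum>k\<in>X. cut A j k) \<le> real (1 + 4 * A 1 * a) * real (sum w {..<A 0})"
    by (simp only: of_nat_le_iff flip: of_nat_mult)
  have "real (sum w {..<A 0}) \<le> 2 * sqrt (A 0) * real (sum w T)"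
    using fin greedy_light_level[OF ST(2) _ T[folded w_def]]
    by (intro layer_cake) (auto simp: w_def split: if_splits)
  moreover have "sum w T \<le> (\<Sum>j\<in>T. \<Sum>k\<in>S. cut A j k)"
    by (intro sum_mono) (auto simp: w_def)
  then have "sum w T \<le> obj A T"
    using obj_ge_cut[of T S A] fin ST by linarith
  then have "real (sum w T) \<le> real (obj A T)" by (simp only: of_nat_le_iff)
  then have "2 * sqrt (A 0) * real (sum w T) \<le> 2 * sqrt (A 0) * real (obj A T)"
    by (intro mult_left_mono) auto
  ultimately have "real (sum w {..<A 0}) \<le> 2 * sqrt (A 0) * real (obj A T)"
    by linarith
  then have "real (1 + 4 * A 1 * a) * real (sum w {..<A 0}) \<le>
      real (1 + 4 * A 1 * a) * (2 * sqrt (A 0) * real (obj A T))"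
    by (intro mult_left_mono) auto
  with 1 show ?thesis by (simp add: mult_ac)
qed

text \<open>Products are split into rows of heavy items, columns of heavy items within light rows,
  and pairs of light items. Rows and columns are paid for by stars, one per heavy item, and the
  pairs by the dense solution.\<close>

lemma approximation:
  assumes star: "\<And>v. v < A 0 \<Longrightarrow> fits A 1 {v} \<Longrightarrow>
      \<exists>S. greedy A 1 (\<lambda>j. cut A v j + gain A j) {v} S \<and> obj A S \<le> Z"
    and S: "greedy A 2 (\<lambda>j. \<Sum>k | k < A 0 \<and> light A k. cut A j k) {} S"
    and T: "greedy A 1 (\<lambda>j. if light A j then \<Sum>k\<in>S. cut A j k else 0) S T" "obj A T \<le> Z"
    and X: "X \<subseteq> {..<A 0}" "fits A 1 X" and a: "1 \<le> a" and p: "A 1 \<le> p"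
  shows "real (obj A X) \<le> 40 * (real p + 1)\<^sup>2 * real a * sqrt (A 0) * real Z"
proof (cases "X = {}")
  case True
  then show ?thesis by (simp add: obj_def)
next
  case False
  define K where "K = 1 + 4 * A 1 * a"
  define H where "H = {j\<in>X. \<not> light A j}"
  define L where "L = {j\<in>X. light A j}"
  have fin: "finite X" "finite H" "finite L"
    using X(1) finite_subset[of _ "{..<A 0}"] by (auto simp: H_def L_def)
  have XHL: "X = H \<union> L" "H \<inter> L = {}" by (auto simp: H_def L_def)
  have star': "(\<Sum>j\<in>X. cut A v j + gain A j) \<le> K * Z" if v: "v \<in> X" for v
  proof -
    obtain S where "greedy A 1 (\<lambda>j. cut A v j + gain A j) {v} S" "obj A S \<le> Z"
      using star[of v] X v fits_subset[of 1 X "{v}"] by auto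
    then have "(\<Sum>j\<in>X. cut A v j + gain A j) \<le> (1 + 3 * A 1 * a) * obj A S"
      using greedy_star X v by blast
    also have "\<dots> \<le> K * Z" using \<open>obj A S \<le> Z\<close> by (intro mult_mono) (auto simp: K_def)
    finally show ?thesis .
  qed
  \<comment> \<open>The star of any single item of \<open>X\<close> already contains the whole
    linear part.\<close>
  have gains: "(\<Sum>j\<in>X. gain A j) \<le> K * Z"
    using False star' by (fastforce simp: sum.distrib)
  have "(\<Sum>j\<in>H. \<Sum>k\<in>X. cut A j k) \<le> (\<Sum>j\<in>H. K * Z)"
    using star' by (intro sum_mono) (fastforce simp: sum.distrib H_def)
  then have heavy: "(\<Sum>j\<in>H. \<Sum>k\<in>X. cut A j k) \<le> card H * (K * Z)" by simp
  have "(\<Sum>j\<in>L. \<Sum>k\<in>H. cut A j k) = (\<Sum>k\<in>H. \<Sum>j\<in>L. cut A k j)"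
    using X by (subst sum.swap) (auto simp: L_def H_def intro!: sum.cong cut_sym)
  also have "\<dots> \<le> (\<Sum>k\<in>H. \<Sum>j\<in>X. cut A k j)"
    using fin by (intro sum_mono sum_mono2) (auto simp: L_def)
  finally have heavy': "(\<Sum>j\<in>L. \<Sum>k\<in>H. cut A j k) \<le> card H * (K * Z)" using heavy by simp
  have "(\<Sum>j\<in>X. \<Sum>k\<in>X. cut A j k) = (\<Sum>j\<in>H. \<Sum>k\<in>X. cut A j k) + (\<Sum>j\<in>L. \<Sum>k\<in>X. cut A j k)"
    using XHL fin by (metis sum.union_disjoint)
  also have "(\<Sum>j\<in>L. \<Sum>k\<in>X. cut A j k) = (\<Sum>j\<in>L. \<Sum>k\<in>H. cut A j k) + (\<Sum>j\<in>L. \<Sum>k\<in>L. cut A j k)"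
    unfolding XHL(1) using XHL(2) fin by (simp add: sum.union_disjoint sum.distrib)
  finally have "obj A X \<le> K * Z + 2 * (card H * (K * Z)) + (\<Sum>j\<in>L. \<Sum>k\<in>L. cut A j k)"
    using gains heavy heavy' by (simp add: obj_def sum.distrib)
  then have "real (obj A X) \<le> real (K * Z + 2 * (card H * (K * Z)) + (\<Sum>j\<in>L. \<Sum>k\<in>L. cut A j k))"
    by (simp only: of_nat_le_iff)
  then have 1: "real (obj A X) \<le> real K * real Z + 2 * (real (card H) * (real K * real Z))
      + real (\<Sum>j\<in>L. \<Sum>k\<in>L. cut A j k)"
    by (simp only: of_nat_add of_nat_mult of_nat_numeral)
  have n1: "1 \<le> sqrt (A 0)" using vars_pos by simp
  define r where "r = sqrt (A 0)"
  have "real (card H) * (real K * real Z) \<le> 2 * real p * r * (real K * real Z)"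
  proof -
    have "real (card H) \<le> 2 * real (A 1) * sqrt (A 0)" unfolding H_def by (rule heavy_card[OF X])
    also have "\<dots> \<le> 2 * real p * r" unfolding r_def using p by (intro mult_right_mono) auto
    finally show ?thesis by (intro mult_right_mono) auto
  qed
  moreover have "real (\<Sum>j\<in>L. \<Sum>k\<in>L. cut A j k) \<le> 2 * r * (real K * real Z)"
  proof -
    have "real (\<Sum>j\<in>L. \<Sum>k\<in>L. cut A j k) \<le> 2 * r * real K * real (obj A T)"
      unfolding K_def r_def using X fits_subset[of 1 X L]
      by (intro greedy_dense[OF S T(1)]) (auto simp: L_def)
    also have "\<dots> \<le> 2 * r * real K * real Z"
      using T(2) n1 by (intro mult_left_mono) (auto simp: r_def)
    finally show ?thesis by (simp add: mult_ac)
  qed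
  moreover have "1 * (real K * real Z) \<le> r * (real K * real Z)"
    using n1 unfolding r_def by (intro mult_right_mono) auto
  \<comment> \<open>In units of \<open>r * K * Z\<close>: 1 for the linear part,
    \<open>2 * 2 * p\<close> for heavy rows and columns, 2 for the light pairs.\<close>
  ultimately have "real (obj A X) \<le> (3 + 4 * real p) * (r * (real K * real Z))"
    using 1 by (simp add: algebra_simps)
  also have "\<dots> \<le> (3 + 4 * real p) * (r * ((1 + 4 * real p) * real a * real Z))"
  proof -
    \<comment> \<open>\<open>a \<ge> 1\<close> is what allows the summand 1 of \<open>K\<close> to
      be absorbed into a multiple of \<open>a\<close>.\<close>
    have "K \<le> 1 * a + 4 * p * a" unfolding K_def using a p by (intro add_mono mult_mono) auto
    then have "real K \<le> real (1 * a + 4 * p * a)" by (simp only: of_nat_le_iff)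
    then have "real K \<le> (1 + 4 * real p) * real a" by (simp add: algebra_simps)
    then show ?thesis using n1 unfolding r_def by (intro mult_left_mono mult_right_mono) auto
  qed
  also have "\<dots> = (3 + 4 * real p) * (1 + 4 * real p) * (real a * r * real Z)"
    by (simp add: mult_ac)
  also have "\<dots> \<le> 40 * (real p + 1)\<^sup>2 * (real a * r * real Z)"
    using n1 unfolding r_def
    by (intro mult_right_mono) (auto simp: power2_eq_square algebra_simps)
  finally show ?thesis by (simp add: r_def mult_ac)
qed

text \<open>For \<open>a = 0\<close> the target factor is 1, so an exact optimum is required. Every
  set fits and all weights are positive thanks to the linear part, so a single star run selects
  every item, and the objective is monotone.\<close>

lemma unconstrained:
  assumes "a = 0" "\<And>v. v < A 0 \<Longrightarrow> fits A 1 {v} \<Longrightarrow>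
      \<exists>S. greedy A 1 (\<lambda>j. cut A v j + gain A j) {v} S \<and> obj A S \<le> Z"
    and "X \<subseteq> {..<A 0}"
  shows "obj A X \<le> Z"
proof -
  have fits: "fits A 1 Y" if "Y \<subseteq> {..<A 0}" for Y
  proof -
    have "usage A i k = 0" if "i < A 1" "k \<in> Y" for i k
      using usage_le[of i k] that \<open>Y \<subseteq> {..<A 0}\<close> assms(1) by auto
    then show ?thesis by (simp add: fits_def)
  qed
  obtain S where S: "greedy A 1 (\<lambda>j. cut A 0 j + gain A j) {0} S" "obj A S \<le> Z"
    using assms(2)[of 0] vars_pos fits[of "{0}"] by auto
  have "j \<in> S" if "j < A 0" for j
  proof (rule ccontr)
    assume "j \<notin> S"
    moreover have "S \<subseteq> {..<A 0}" using S(1) by (simp add: greedy_def)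
    then have "fits A 1 (insert j {k\<in>S. k \<in> {0} \<or> cut A 0 j + gain A j \<le> cut A 0 k + gain A k})"
      using that by (intro fits) auto
    ultimately show False using S(1) that gain_pos[OF that] unfolding greedy_def by auto
  qed
  then have "X \<subseteq> S" using assms(3) by auto
  moreover have "finite S" using S(1) finite_subset[of S "{..<A 0}"] by (auto simp: greedy_def)
  ultimately show ?thesis using obj_mono[of X S A] S(2) by simp
qed

end


section \<open>Instances and their encodings\<close>

lemma length_concat_uniform:
  "(\<And>i. i < r \<Longrightarrow> length (f i) = c) \<Longrightarrow> length (concat (map f [0..<r])) = r * c"
  by (induction r) auto

lemma index_less:
  fixes c :: nat
  assumes "i < r" "j < c"
  shows "i * c + j < r * c"
proof -
  have "i * c + j < Suc i * c" using assms(2) by simp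
  also have "\<dots> \<le> r * c" using assms(1) by (intro mult_right_mono) auto
  finally show ?thesis .
qed

lemma nth_concat_uniform:
  assumes "\<And>i. i < r \<Longrightarrow> length (f i) = c" "i < r" "j < c"
  shows "concat (map f [0..<r]) ! (i * c + j) = f i ! j"
  using assms
proof (induction r)
  case (Suc r)
  have len: "length (concat (map f [0..<r])) = r * c"
    using Suc.prems by (intro length_concat_uniform) auto
  show ?case
  proof (cases "i < r")
    case True
    then have "i * c + j < r * c"
      using Suc.prems(3) by (rule index_less)
    then show ?thesis using True Suc len by (simp add: nth_append)
  next
    case False
    then have "i = r" using Suc.prems by simp
    then show ?thesis using len nth_append_length_plus[of "concat (map f [0..<r])"] by simp
  qed
qed simp

context
  fixes I :: piqp
  assumes I: "is_piqp I"
begin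

abbreviation (input) "data \<equiv> init_mem (encode I) 0"

definition den :: "nat \<Rightarrow> nat" where
  "den i = nat (snd (quotient_of (bnd I $ i)))"

definition num :: "nat \<Rightarrow> nat" where
  "num i = nat (fst (quotient_of (bnd I $ i)))"

lemma dims:
  "dim_row (quad I) = num_vars I" "dim_col (quad I) = num_vars I" "dim_vec (lin I) = num_vars I"
  "dim_row (con I) = num_cons I" "dim_col (con I) = num_vars I" "dim_vec (bnd I) = num_cons I"
  using I by (auto simp: is_piqp_def num_vars_def num_cons_def)

lemma encode_eq:
  "encode I = [num_vars I, num_cons I] @
     concat (map (\<lambda>i. map (\<lambda>j. quad I $$ (i, j)) [0..<num_vars I]) [0..<num_vars I]) @
     map (($) (lin I)) [0..<num_vars I] @
     concat (map (\<lambda>i. map (\<lambda>j. con I $$ (i, j)) [0..<num_vars I]) [0..<num_cons I]) @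
     concat (map (\<lambda>i. [num i, den i]) [0..<num_cons I])"
  by (simp add: encode_def mat_to_list_def dims list_of_vec_map num_def den_def comp_def case_prod_beta)

lemma nth_part: "k < length bs \<Longrightarrow> length as = l \<Longrightarrow> (as @ bs @ cs) ! (l + k) = bs ! k"
  by (simp add: nth_append)

lemma length_encode:
  "length (encode I) = 2 + num_vars I * num_vars I + num_vars I + num_cons I * num_vars I + num_cons I * 2"
  by (simp add: encode_eq length_concat_uniform)

lemma data_eq: "i < length (encode I) \<Longrightarrow> data i = encode I ! i"
  by (simp add: init_mem_def)

lemma data_dims: "data 0 = num_vars I" "data 1 = num_cons I"
  by (simp_all add: init_mem_def length_encode) (simp_all add: encode_eq)

lemma data_quad:
  assumes "j < num_vars I" "k < num_vars I"
  shows "cut data j k = quad I $$ (j, k)"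
proof -
  let ?Q = "concat (map (\<lambda>i. map (\<lambda>j. quad I $$ (i, j)) [0..<num_vars I]) [0..<num_vars I])"
  have lt: "j * num_vars I + k < num_vars I * num_vars I" using assms by (rule index_less)
  have "cut data j k = encode I ! (2 + (j * num_vars I + k))"
    using lt by (simp add: cut_def data_dims data_eq length_encode add.assoc)
  also have "\<dots> = ?Q ! (j * num_vars I + k)"
    unfolding encode_eq using lt by (intro nth_part) (auto simp: length_concat_uniform)
  also have "\<dots> = quad I $$ (j, k)"
    using assms by (subst nth_concat_uniform) auto
  finally show ?thesis .
qed

lemma data_lin:
  assumes "j < num_vars I"
  shows "gain data j = lin I $ j"
proof -
  have "gain data j = encode I ! ((2 + num_vars I * num_vars I) + j)"
    using assms by (simp add: gain_def data_dims data_eq length_encode)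
  also have "\<dots> = map (($) (lin I)) [0..<num_vars I] ! j"
    unfolding encode_eq append.assoc[symmetric, of "[num_vars I, num_cons I]"]
    using assms by (intro nth_part) (auto simp: length_concat_uniform)
  finally show ?thesis using assms by simp
qed

lemma data_con:
  assumes "i < num_cons I" "j < num_vars I"
  shows "data (2 + data 0 * data 0 + data 0 + i * data 0 + j) = con I $$ (i, j)"
proof -
  let ?C = "concat (map (\<lambda>i. map (\<lambda>j. con I $$ (i, j)) [0..<num_vars I]) [0..<num_cons I])"
  have lt: "i * num_vars I + j < num_cons I * num_vars I" using assms by (rule index_less)
  have "data (2 + data 0 * data 0 + data 0 + i * data 0 + j)
      = encode I ! ((2 + num_vars I * num_vars I + num_vars I) + (i * num_vars I + j))"
    using lt by (simp add: data_dims data_eq length_encode add.assoc)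
  also have "\<dots> = ?C ! (i * num_vars I + j)"
    unfolding encode_eq append.assoc[symmetric, of "[num_vars I, num_cons I]"]
      append.assoc[symmetric, of _ "map (($) (lin I)) [0..<num_vars I]"]
    using lt by (intro nth_part) (auto simp: length_concat_uniform)
  also have "\<dots> = con I $$ (i, j)"
    using assms by (subst nth_concat_uniform) auto
  finally show ?thesis .
qed

lemma data_bnd:
  assumes "i < num_cons I" "b < 2"
  shows "data (2 + data 0 * data 0 + data 0 + data 1 * data 0 + 2 * i + b) = [num i, den i] ! b"
proof -
  let ?D = "concat (map (\<lambda>i. [num i, den i]) [0..<num_cons I])"
  have lt: "i * 2 + b < num_cons I * 2" using assms by (rule index_less)
  have "encode I ! ((2 + num_vars I * num_vars I + num_vars I + num_cons I * num_vars I) + (i * 2 + b))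
      = ?D ! (i * 2 + b)"
    unfolding encode_eq by (simp add: nth_append length_concat_uniform add.assoc)
  also have "\<dots> = [num i, den i] ! b"
    using assms by (subst nth_concat_uniform) auto
  finally show ?thesis
    using lt by (simp add: data_dims data_eq length_encode add.assoc mult.commute[of 2])
qed

lemma den_pos: "0 < den i"
  using quotient_of_denom_pos'[of "bnd I $ i"] by (simp add: den_def)

lemma num_pos:
  assumes "i < num_cons I"
  shows "0 < num i"
proof -
  obtain u v where uv: "quotient_of (bnd I $ i) = (u, v)" by fastforce
  then have "bnd I $ i = of_int u / of_int v" "0 < v"
    using quotient_of_div quotient_of_denom_pos by blast+
  moreover have "0 < bnd I $ i" using I assms by (simp add: is_piqp_def)
  ultimately have "0 < u" by (simp add: zero_less_divide_iff)
  then show ?thesis using uv by (simp add: num_def)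
qed

lemma bnd_eq:
  assumes "i < num_cons I"
  shows "bnd I $ i = of_nat (num i) / of_nat (den i)"
proof -
  obtain u v where uv: "quotient_of (bnd I $ i) = (u, v)" by fastforce
  then have "bnd I $ i = of_int u / of_int v" "0 < v"
    using quotient_of_div quotient_of_denom_pos by blast+
  moreover have "0 < u" using num_pos[OF assms] uv by (simp add: num_def)
  ultimately show ?thesis using uv by (simp add: num_def den_def)
qed

lemma usage_eq: "\<lbrakk>i < num_cons I; j < num_vars I\<rbrakk> \<Longrightarrow> usage data i j = con I $$ (i, j) * den i"
  using data_con[of i j] data_bnd[of i 1] by (simp add: usage_def)

lemma budget_eq: "i < num_cons I \<Longrightarrow> budget data i = num i"
  using data_bnd[of i 0] by (simp add: budget_def)

lemma le_a_max: "i < num_cons I \<Longrightarrow> j < num_vars I \<Longrightarrow> con I $$ (i, j) \<le> a_max I"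
  unfolding a_max_def
  by (intro Max_ge) (auto intro!: elements_matI[of _ "num_cons I" "num_vars I"] simp: dims, simp add: elements_mat_def)

lemma packing_data: "packing data (a_max I) den"
proof
  show "0 < data 0" using I by (simp add: data_dims is_piqp_def)
  show "cut data j k = cut data k j" if "j < data 0" "k < data 0" for j k
  proof -
    have "quad I $$ (k, j) = transpose_mat (quad I) $$ (j, k)"
      using that by (simp add: data_dims dims)
    then show ?thesis using I that by (simp add: data_dims data_quad is_piqp_def)
  qed
  show "0 < gain data j" if "j < data 0" for j
    using I that by (simp add: data_dims data_lin is_piqp_def)
  show "0 < budget data i" if "i < data 1" for i
    using that by (simp only: data_dims budget_eq num_pos)
  show "usage data i k \<le> a_max I * den i" if "i < data 1" "k < data 0" for i k
    using that by (simp only: data_dims usage_eq le_a_max mult_right_mono zero_le)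
  show "den i \<le> usage data i k" if "i < data 1" "k < data 0" "0 < usage data i k" for i k
    using that by (simp add: data_dims usage_eq)
qed (rule den_pos)

section \<open>Correspondence between item sets and 0-1 vectors\<close>

lemma sum_ind_mult:
  assumes "T \<subseteq> {..<n}"
  shows "(\<Sum>i=0..<n. ind T i * f i) = sum f T" "(\<Sum>i=0..<n. f i * ind T i) = sum f T"
  using assms by (auto simp: ind_def intro!: sum.mono_neutral_cong_right)

lemma objective_ind:
  assumes "T \<subseteq> {..<num_vars I}"
  shows "objective I (vec (num_vars I) (ind T)) = obj data T"
proof -
  have "objective I (vec (num_vars I) (ind T)) =
      (\<Sum>i=0..<num_vars I. ind T i * (\<Sum>k=0..<num_vars I. quad I $$ (i, k) * ind T k)) +
      (\<Sum>i=0..<num_vars I. lin I $ i * ind T i)"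
    by (simp add: objective_def scalar_prod_def dims)
  also have "\<dots> = (\<Sum>j\<in>T. \<Sum>k\<in>T. quad I $$ (j, k)) + (\<Sum>j\<in>T. lin I $ j)"
    by (simp add: sum_ind_mult[OF assms])
  also have "\<dots> = obj data T"
    using assms by (auto simp: obj_def sum.distrib data_quad data_lin subset_eq)
  finally show ?thesis .
qed

lemma feasible_ind:
  assumes "T \<subseteq> {..<num_vars I}"
  shows "feasible I (vec (num_vars I) (ind T)) \<longleftrightarrow> fits data 1 T"
proof -
  have "of_nat (row (con I) i \<bullet> vec (num_vars I) (ind T)) \<le> bnd I $ i \<longleftrightarrow>
      1 * (\<Sum>k\<in>T. usage data i k) \<le> budget data i" if i: "i < num_cons I" for i
  proof -
    have row: "row (con I) i \<bullet> vec (num_vars I) (ind T) = (\<Sum>k\<in>T. con I $$ (i, k))"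
      using i by (simp add: scalar_prod_def dims sum_ind_mult[OF assms])
    have "(\<Sum>k\<in>T. usage data i k) = (\<Sum>k\<in>T. con I $$ (i, k)) * den i"
      using assms i by (auto simp: usage_eq sum_distrib_right subset_eq intro!: sum.cong)
    moreover have "(of_nat (\<Sum>k\<in>T. con I $$ (i, k)) :: rat) \<le> bnd I $ i \<longleftrightarrow>
        of_nat ((\<Sum>k\<in>T. con I $$ (i, k)) * den i) \<le> (of_nat (num i) :: rat)"
      using den_pos[of i] bnd_eq[OF i] by (simp add: pos_le_divide_eq del: of_nat_sum)
    ultimately show ?thesis
      unfolding row using budget_eq[OF i] by (simp only: of_nat_le_iff mult_1)
  qed
  then show ?thesis by (auto simp: feasible_def fits_def data_dims ind_def)
qed

lemma feasible_eq_ind: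
  assumes "feasible I x"
  obtains T where "T \<subseteq> {..<num_vars I}" "x = vec (num_vars I) (ind T)"
proof
  show "{j. j < num_vars I \<and> x $ j = 1} \<subseteq> {..<num_vars I}" by auto
  show "x = vec (num_vars I) (ind {j. j < num_vars I \<and> x $ j = 1})"
    using assms by (intro eq_vecI) (auto simp: feasible_def ind_def)
qed

lemma optimum_attained:
  obtains X where "X \<subseteq> {..<num_vars I}" "fits data 1 X" "optimum I = obj data X"
proof -
  have "optimum I \<in> objective I ` {x. feasible I x}"
    unfolding optimum_def using finite_feasible feasible_zero[OF I] by (intro Max_in) auto
  then obtain x where x: "feasible I x" "optimum I = objective I x" by auto
  obtain X where "X \<subseteq> {..<num_vars I}" "x = vec (num_vars I) (ind X)"
    using x(1) by (rule feasible_eq_ind)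
  then show ?thesis using x that by (simp add: feasible_ind objective_ind)
qed

lemma output_correct:
  obtains T where "sem piqp_prog (init_mem (encode I)) 1 = ind T" "T \<subseteq> {..<num_vars I}"
    "feasible I (vec (num_vars I) (ind T))"
    "a_max I = 0 \<Longrightarrow> optimum I \<le> objective I (vec (num_vars I) (ind T))"
    "\<lbrakk>1 \<le> a_max I; num_cons I \<le> p\<rbrakk> \<Longrightarrow> real (optimum I) \<le>
      40 * (real p + 1)\<^sup>2 * real (a_max I) * sqrt (num_vars I) * real (objective I (vec (num_vars I) (ind T)))"
proof -
  interpret packing data "a_max I" den by (rule packing_data)
  obtain X where X: "X \<subseteq> {..<data 0}" "fits data 1 X" "optimum I = obj data X"
    unfolding data_dims by (rule optimum_attained)
  obtain T S1 S2 where T: "sem piqp_prog (init_mem (encode I)) 1 = ind T" "T \<subseteq> {..<data 0}" "fits data 1 T"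
    "\<And>v. v < data 0 \<Longrightarrow> fits data 1 {v} \<Longrightarrow>
      \<exists>S. greedy data 1 (\<lambda>j. cut data v j + gain data j) {v} S \<and> obj data S \<le> obj data T"
    "greedy data 2 (\<lambda>j. \<Sum>k | k < data 0 \<and> light data k. cut data j k) {} S1"
    "greedy data 1 (\<lambda>j. if light data j then \<Sum>k\<in>S1. cut data j k else 0) S1 S2"
    "obj data S2 \<le> obj data T"
    using sem_piqp_prog[OF refl, of "encode I"] by blast
  have T': "T \<subseteq> {..<num_vars I}" using T(2) data_dims by simp
  show ?thesis
  proof (rule that[OF T(1) T'])
    show "feasible I (vec (num_vars I) (ind T))" using T(3) T' by (simp add: feasible_ind)
    show "optimum I \<le> objective I (vec (num_vars I) (ind T))" if "a_max I = 0"
      using unconstrained[OF that T(4) X(1)] X(3) T' by (simp add: objective_ind)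
    show "real (optimum I) \<le> 40 * (real p + 1)\<^sup>2 * real (a_max I) * sqrt (num_vars I) *
        real (objective I (vec (num_vars I) (ind T)))" if "1 \<le> a_max I" "num_cons I \<le> p"
      using approximation[OF T(4-7) X(1,2) that(1), of p] X(3) T' that(2)
      by (simp add: objective_ind data_dims)
  qed
qed

end

section \<open>Polynomial time and the stated factor\<close>

theorem theorem4p2:
  fixes \<gamma> :: real and p :: nat
  assumes "0 < \<gamma>"
  shows "\<exists>C>0. \<forall>k::nat. \<exists>(c::com) (q::nat poly). \<forall>I.
           is_piqp I \<and> num_cons I \<le> p \<longrightarrow>
           (let n = num_vars I;
                \<alpha> = max 1 (C * real (a_max I) * sqrt (real n) * ln (real n) powr (2 + \<gamma>));
                T = poly q (input_size (encode I))
            in halts_within c (encode I) T \<and>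
               output_prob c (encode I) T (\<lambda>out. approx_solution I \<alpha> (vec n out))
                 \<ge> 1 - 1 / real n ^ k)"
proof -
  define D where "D = 40 * (real p + 1)\<^sup>2"
  \<comment> \<open>For \<open>n \<ge> 2\<close> the logarithmic factor is at least
    \<open>ln 2 powr (2 + \<gamma>)\<close>, so \<open>C\<close> times it is at least
    \<open>D\<close>.\<close>
  define C where "C = D / ln 2 powr (2 + \<gamma>)"
  have D: "0 < D" by (simp add: D_def)
  have C: "0 < C" using D by (simp add: C_def)
  obtain q where q: "\<And>xs. \<lbrakk>0 < length xs; init_mem xs 0 0 \<le> input_size xs; init_mem xs 0 1 \<le> input_size xs\<rbrakk>
    \<Longrightarrow> \<exists>t \<le> poly q (input_size xs).
      \<forall>rs. exec (compile piqp_prog) (init_mem xs) rs t (sem piqp_prog (init_mem xs)) rs"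
    using compile_polynomial[OF wf_piqp_prog] by blast
  have "let n = num_vars I;
            \<alpha> = max 1 (C * real (a_max I) * sqrt (real n) * ln (real n) powr (2 + \<gamma>));
            T = poly q (input_size (encode I))
        in halts_within (compile piqp_prog) (encode I) T \<and>
           output_prob (compile piqp_prog) (encode I) T (\<lambda>out. approx_solution I \<alpha> (vec n out))
             \<ge> 1 - 1 / real n ^ k"
    if I: "is_piqp I" and p: "num_cons I \<le> p" for k I
  proof -
    define n where "n = num_vars I"
    define \<alpha> where "\<alpha> = max 1 (C * real (a_max I) * sqrt (real n) * ln (real n) powr (2 + \<gamma>))"
    define T where "T = poly q (input_size (encode I))"
    define M where "M = sem piqp_prog (init_mem (encode I))"
    \<comment> \<open>The encoding lists at least \<open>n\<close> and at least
      \<open>num_cons I\<close> numbers, so the loop limits are bounded by the input size as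
      numbers, not just in bit length.\<close>
    have len: "n \<le> length (encode I)" "num_cons I \<le> length (encode I)" "0 < length (encode I)"
      by (simp_all add: length_encode[OF I] n_def)
    obtain t where t: "t \<le> T" "\<And>rs. exec (compile piqp_prog) (init_mem (encode I)) rs t M rs"
      using q[of "encode I"] len length_le_input_size[of "encode I"] data_dims[OF I]
      unfolding T_def M_def n_def by fastforce
    have halts: "halts_within (compile piqp_prog) (encode I) T"
      using t unfolding halts_within_def by blast
    obtain S where S: "M 1 = ind S" "feasible I (vec n (ind S))"
      "a_max I = 0 \<Longrightarrow> optimum I \<le> objective I (vec n (ind S))"
      "1 \<le> a_max I \<Longrightarrow> real (optimum I) \<le>
        D * real (a_max I) * sqrt n * real (objective I (vec n (ind S)))"
      using output_correct[OF I, of p] p unfolding M_def n_def D_def by metis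
    have "output_prob (compile piqp_prog) (encode I) T (\<lambda>out. approx_solution I \<alpha> (vec n out))
        \<ge> 1 - 1 / real n ^ k"
    \<comment> \<open>For \<open>n = 1\<close> the logarithm vanishes and offers no slack, but the
      required probability is 0 as well.\<close>
    proof (cases "n = 1")
      case True
      then show ?thesis by (simp add: output_prob_def)
    next
      case False
      then have n: "2 \<le> n" using I by (simp add: is_piqp_def n_def)
      have \<alpha>: "1 \<le> \<alpha>" by (simp add: \<alpha>_def)
      have "real (optimum I) \<le> \<alpha> * real (objective I (vec n (ind S)))"
      proof (cases "a_max I = 0")
        case True
        then have "1 * real (optimum I) \<le> \<alpha> * real (objective I (vec n (ind S)))"
          using S(3) \<alpha> by (intro mult_mono) auto
        then show ?thesis by simp
      next
        case False
        have "ln 2 powr (2 + \<gamma>) \<le> ln (real n) powr (2 + \<gamma>)"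
          using n assms by (intro powr_mono2) auto
        then have "D \<le> C * ln (real n) powr (2 + \<gamma>)"
          using D by (simp add: C_def pos_le_divide_eq mult_left_mono)
        then have "D * (real (a_max I) * sqrt n) \<le> (C * ln (real n) powr (2 + \<gamma>)) * (real (a_max I) * sqrt n)"
          by (intro mult_right_mono) auto
        then have "D * real (a_max I) * sqrt n \<le> \<alpha>"
          by (simp add: \<alpha>_def mult_ac)
        then have "D * real (a_max I) * sqrt n * real (objective I (vec n (ind S)))
            \<le> \<alpha> * real (objective I (vec n (ind S)))"
          by (intro mult_right_mono) auto
        then show ?thesis using S(4) False by linarith
      qed
      then have "1 / \<alpha> * real (optimum I) \<le> real (objective I (vec n (ind S)))"
        using \<alpha> by (simp add: pos_divide_le_eq mult.commute)
      then have "approx_solution I \<alpha> (vec n (M 1))"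
        using S by (simp add: approx_solution_def)
      \<comment> \<open>The program tosses no coin, so every sequence of tosses succeeds. One
        program and one polynomial therefore serve for all \<open>k\<close>.\<close>
      then have "{rs. \<exists>t M' rs'. exec (compile piqp_prog) (init_mem (encode I)) rs t M' rs' \<and>
          approx_solution I \<alpha> (vec n (M' 1))} = UNIV"
        using t(2) by blast
      then show ?thesis by (simp add: output_prob_def)
    qed
    with halts show ?thesis
      unfolding Let_def T_def \<alpha>_def n_def by blast
  qed
  with C show ?thesis by blast
qed

end
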